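(* Assume the coefficients are centered with unit variance and admit a finite third moment, and let $X$ be uniform on $[0,2\pi]$. Then $\mathbb P$-almost surely, if $G$ is $\sigma(X)$-measurable with $G\sim\mathcal N(0,1)$ under $\mathbb P_X$, \[ \lim_{n\to\infty} d^X_{TV}(f_n(X),G)=0. \]
   Context: On a probability space $(\Omega,\mathcal F,\mathbb P)$ let $(a_k)_{k\ge1}$ and $(b_k)_{k\ge1}$ be random variables such that all the $a_k,b_k$ are mutually independent with a common distribution. For $n\ge1$ and $t\in\mathbb R$ let $f_n(t)=\frac{1}{\sqrt n}\sum_{k=1}^n \big(a_k\cos(kt)+b_k\sin(kt)\big)$. $X$ is independent of the coefficients (product space $\Omega\times[0,2\pi]$ with $\mathbb P\otimes\mathbb P_X$); $\mathbb E_X$ denotes expectation with respect to $X$ only, coefficients fixed. For $U,V$ measurable w.r.t. $\mathcal F\otimes\mathcal B([0,2\pi])$, $d^X_{TV}(U,V):=\sup\{\mathbb E_X[\phi(U)-\phi(V)]:\ \phi \text{ measurable},\ \|\phi\|_\infty\le1\}$. *)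

theory Defs
  imports "HOL-Probability.Probability"
begin

definition trig_poly :: "(nat \<Rightarrow> 'a \<Rightarrow> real) \<Rightarrow> (nat \<Rightarrow> 'a \<Rightarrow> real) \<Rightarrow> nat \<Rightarrow> 'a \<Rightarrow> real \<Rightarrow> real" where
  "trig_poly a b n w t =
     (1 / sqrt (real n)) * (\<Sum>k=1..n. a k w * cos (real k * t) + b k w * sin (real k * t))"

definition PX :: "real measure" where
  "PX = uniform_measure lborel {0..2*pi}"

definition dTV_X :: "real measure \<Rightarrow> (real \<Rightarrow> real) \<Rightarrow> (real \<Rightarrow> real) \<Rightarrow> real" where
  "dTV_X P U V =
     (SUP \<phi> \<in> {\<phi> \<in> borel_measurable borel. \<forall>y. \<bar>\<phi> y\<bar> \<le> 1}.
        (\<integral>x. \<phi> (U x) \<partial>P) - (\<integral>x. \<phi> (V x) \<partial>P))"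

end

theory Submission
  imports Defs
begin

text \<open>
  Write \<open>F = f\<^sub>n\<close>, \<open>D = f\<^sub>n' / n\<close>, \<open>S = f\<^sub>n'' / n\<^sup>2\<close>. If \<open>\<psi>' = \<phi>\<close> and \<open>\<bar>\<psi>\<bar> \<le> h\<close>, integrating the derivative of
  \<open>\<psi>(F) D / (D\<^sup>2 + \<epsilon>)\<close> over a period bounds the mean of \<open>\<phi>(F)\<close> by
  \<open>(h / \<epsilon>) E\<bar>S\<bar> + \<parallel>\<phi>\<parallel> E[\<epsilon> / (D\<^sup>2 + \<epsilon>)]\<close>. Applied to the difference of a test function and its average over
  intervals of length \<open>h\<close>, this reduces total variation convergence to the convergence in law of
  \<open>F(X)\<close>, the convergence in law of \<open>D(X)\<close> to a limit without atom at 0, and the boundedness of \<open>E S\<^sup>2\<close>.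

  Both convergences hold almost surely: a third moment gives the joint characteristic function of
  \<open>D(x)\<close> and \<open>D(y)\<close> up to \<open>O(1 / sqrt n)\<close>, hence \<open>E\<^sub>X exp(i\<xi>D(X))\<close> has variance \<open>O(1 / sqrt n)\<close>. This is summable
  along \<open>n = m\<^sup>4\<close>, and the gaps are filled using the law of large numbers for the squared coefficients.
\<close>

subsection \<open>Uniform averages of trigonometric polynomials\<close>

text \<open>For frozen coefficients \<open>F(X)\<close> is a smooth function of one uniform
  variable, and its law can have an unbounded density near the critical values of \<open>F\<close>.
  Regularity therefore holds only on average, and its price is the mass that \<open>D(X)\<close>
  puts near 0. The powers of \<open>n\<close> in \<open>D\<close> and \<open>S\<close> are chosen so
  that \<open>F' = n D\<close> and \<open>D' = n S\<close> contribute the same factor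
  \<open>n\<close>; the two cancel and the estimate is uniform in \<open>n\<close>. The parameters
  are fixed in the order \<epsilon> (from the limit law of \<open>D\<close>), then \<open>h\<close>
  proportional to \<epsilon>, then \<open>n\<close>. The limit of \<open>D(X)\<close> is Gaussian
  with variance 1/3, the integral of s^2 over [0,1], and so has no atom.

  Two uncountable families threaten an almost sure statement. For the frequencies \<xi>, only
  rational values are treated almost surely, and a Lipschitz bound in \<xi>, uniform in
  \<open>n\<close>, gives the rest. For the Gaussian variables \<open>G\<close>, total variation
  sees \<open>G\<close> through its law alone, so that a single null set serves all of them.\<close>

lemma sets_PX [simp, measurable_cong]: "sets PX = sets borel"
  by (simp add: PX_def)

lemma space_PX [simp]: "space PX = UNIV"
  by (simp add: PX_def)

lemma prob_space_PX: "prob_space PX"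
  unfolding PX_def by (rule prob_space_uniform_measure) auto

interpretation PX: prob_space PX
  by (rule prob_space_PX)

lemma PX_integral_FTC:
  fixes f F :: "real \<Rightarrow> real"
  assumes F: "\<And>x. (F has_real_derivative f x) (at x)" and f: "continuous_on UNIV f"
  shows "(\<integral>x. f x \<partial>PX) = (F (2 * pi) - F 0) / (2 * pi)"
proof -
  have [measurable]: "f \<in> borel_measurable borel"
    using f by (rule borel_measurable_continuous_onI)
  have "PX = density lborel (\<lambda>x. indicator {0..2*pi} x / emeasure lborel {0..2*pi})"
    by (simp add: PX_def uniform_measure_def)
  also have "\<dots> = density lborel (\<lambda>x. ennreal (indicator {0..2*pi} x / (2*pi)))"
    by (intro arg_cong[where f="density lborel"] ext)
       (simp add: divide_ennreal flip: ennreal_indicator)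
  finally have d: "PX = density lborel (\<lambda>x. ennreal (indicator {0..2*pi} x / (2*pi)))" .
  have "(\<integral>x. f x \<partial>PX) = (\<integral>x. (indicator {0..2*pi} x / (2*pi)) *\<^sub>R f x \<partial>lborel)"
    unfolding d by (subst integral_density) simp_all
  also have "\<dots> = (\<integral>x. (1 / (2*pi)) * (indicator {0..2*pi} x *\<^sub>R f x) \<partial>lborel)"
    by (simp add: field_simps)
  also have "\<dots> = (1 / (2*pi)) * (\<integral>x. indicator {0..2*pi} x *\<^sub>R f x \<partial>lborel)"
    by (rule integral_mult_right_zero)
  also have "(\<integral>x. indicator {0..2*pi} x *\<^sub>R f x \<partial>lborel) = F (2*pi) - F 0"
    using F f by (intro integral_FTC_atLeastAtMost)
      (auto intro: has_field_derivative_at_within continuous_on_subset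
        simp flip: has_real_derivative_iff_has_vector_derivative)
  finally show ?thesis by simp
qed

lemma PX_integrable_continuous:
  fixes f :: "real \<Rightarrow> real"
  assumes "continuous_on UNIV f"
  shows "integrable PX f"
proof -
  have [measurable]: "f \<in> borel_measurable borel"
    using assms by (rule borel_measurable_continuous_onI)
  have "bounded (f ` {0..2*pi})"
    using assms by (intro compact_imp_bounded compact_continuous_image)
      (auto intro: continuous_on_subset)
  then obtain B where B: "\<And>x. x \<in> {0..2*pi} \<Longrightarrow> norm (f x) \<le> B"
    unfolding bounded_iff by blast
  have "AE x in PX. x \<in> {0..2*pi}"
    unfolding PX_def by (rule AE_uniform_measureI) auto
  then have "AE x in PX. norm (f x) \<le> B"
    by eventually_elim (rule B)
  then show ?thesis
    by (intro PX.integrable_const_bound[where B=B]) auto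
qed

lemma PX_integral_cos:
  fixes c :: real and j :: int
  assumes "j \<noteq> 0"
  shows "(\<integral>x. cos (of_int j * x + c) \<partial>PX) = 0"
proof -
  have "(\<integral>x. cos (of_int j * x + c) \<partial>PX)
        = (sin (of_int j * (2*pi) + c) / of_int j - sin (of_int j * 0 + c) / of_int j) / (2*pi)"
    using assms
    by (intro PX_integral_FTC) (auto intro!: derivative_eq_intros continuous_intros)
  also have "sin (of_int j * (2*pi) + c) = sin c"
    using sin_int_2pin[of j] cos_int_2pin[of j] by (simp add: sin_add mult_ac)
  finally show ?thesis by simp
qed

lemma PX_integral_cos_diff:
  assumes "k \<noteq> l"
  shows "(\<integral>x. cos ((real k - real l) * x + c) \<partial>PX) = 0"
  using PX_integral_cos[of "int k - int l" c] assms by simp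

lemma PX_integral_cos_sum:
  assumes "k > 0"
  shows "(\<integral>x. cos ((real k + real l) * x + c) \<partial>PX) = 0"
  using PX_integral_cos[of "int k + int l" c] assms by simp

text \<open>Orthogonality with a common phase \<theta>, so that it applies to a trigonometric
  polynomial and to its derivatives alike. \<open>k > 0\<close> makes the frequency
  \<open>k + l\<close> nonzero; the frequency \<open>k - l\<close> survives only on the
  diagonal.\<close>

lemma PX_harmonic_product:
  fixes \<alpha> \<beta> \<alpha>' \<beta>' \<theta> :: real
  assumes "k > 0"
  shows "(\<integral>t. (\<alpha> * cos (real k * t + \<theta>) + \<beta> * sin (real k * t + \<theta>))
             * (\<alpha>' * cos (real l * t + \<theta>) + \<beta>' * sin (real l * t + \<theta>)) \<partial>PX)
         = (if k = l then (\<alpha> * \<alpha>' + \<beta> * \<beta>') / 2 else 0)"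
proof -
  define s d where "s t = (real k + real l) * t" and "d t = (real k - real l) * t" for t
  have int: "integrable PX (\<lambda>t. cos (s t + c))" "integrable PX (\<lambda>t. cos (d t + c))" for c
    unfolding s_def d_def by (intro PX_integrable_continuous continuous_intros)+
  have s0: "(\<integral>t. cos (s t + c) \<partial>PX) = 0" for c
    unfolding s_def using assms by (rule PX_integral_cos_sum)
  have d0: "(\<integral>t. cos (d t + c) \<partial>PX) = (if k = l then cos c else 0)" for c
    unfolding d_def using PX_integral_cos_diff[of k l c] by (auto simp: PX.prob_space[simplified])
  \<comment> \<open>Product-to-sum formulas with every sine written as a cosine shifted by
    \<open>pi / 2\<close>: the two cosine integrals above then suffice, and the cross terms vanish
    on the diagonal because cos(-pi/2) = 0.\<close>
  have eq: "(\<alpha> * cos (real k * t + \<theta>) + \<beta> * sin (real k * t + \<theta>))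
       * (\<alpha>' * cos (real l * t + \<theta>) + \<beta>' * sin (real l * t + \<theta>))
     = (\<alpha> * \<alpha>' + \<beta> * \<beta>') / 2 * cos (d t + 0) + (\<alpha> * \<alpha>' - \<beta> * \<beta>') / 2 * cos (s t + 2 * \<theta>)
       + (\<alpha> * \<beta>' + \<beta> * \<alpha>') / 2 * cos (s t + (2 * \<theta> - pi / 2))
       + (\<beta> * \<alpha>' - \<alpha> * \<beta>') / 2 * cos (d t + - (pi / 2))" for t
  proof -
    have a: "d t + 0 = (real k * t + \<theta>) - (real l * t + \<theta>)"
      "s t + 2 * \<theta> = (real k * t + \<theta>) + (real l * t + \<theta>)"
      "s t + (2 * \<theta> - pi / 2) = ((real k * t + \<theta>) + (real l * t + \<theta>)) - pi / 2"
      "d t + - (pi / 2) = ((real k * t + \<theta>) - (real l * t + \<theta>)) - pi / 2"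
      by (auto simp: s_def d_def algebra_simps)
    have b: "cos (x - pi / 2) = sin x" for x :: real
      by (simp add: cos_diff)
    show ?thesis
      unfolding a b cos_diff cos_add sin_diff sin_add by (simp add: field_simps)
  qed
  show ?thesis
    unfolding eq
    by (simp only: Bochner_Integration.integral_add Bochner_Integration.integrable_add
        integrable_mult_right int
        integral_mult_right_zero s0 d0) simp
qed

text \<open>This is the \<open>p\<close>-th derivative of f_n divided by n^p: each differentiation
  brings down a factor \<open>k\<close> and advances the phase by \<open>pi / 2\<close>. The orders
  0, 1, 2 are \<open>F\<close>, \<open>D\<close>, \<open>S\<close>. The coefficients are plain
  sequences because everything up to the convergence criterion is deterministic.\<close>

definition harmonic_sum :: "nat \<Rightarrow> nat \<Rightarrow> (nat \<Rightarrow> real) \<Rightarrow> (nat \<Rightarrow> real) \<Rightarrow> real \<Rightarrow> real" where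
  "harmonic_sum p n u v t = (1 / sqrt (real n)) * (\<Sum>k=1..n. (real k / real n) ^ p
     * (u k * cos (real k * t + real p * pi / 2) + v k * sin (real k * t + real p * pi / 2)))"

lemma trig_poly_eq_harmonic_sum:
  "trig_poly a b n w = harmonic_sum 0 n (\<lambda>k. a k w) (\<lambda>k. b k w)"
  by (rule ext) (simp add: trig_poly_def harmonic_sum_def)

lemma continuous_on_harmonic_sum [continuous_intros]: "continuous_on A (harmonic_sum p n u v)"
  unfolding harmonic_sum_def by (intro continuous_intros)

lemma harmonic_sum_measurable [measurable]: "harmonic_sum p n u v \<in> borel_measurable borel"
  by (intro borel_measurable_continuous_onI continuous_intros)

lemma has_derivative_harmonic_sum:
  assumes "n > 0"
  shows "(harmonic_sum p n u v has_real_derivative real n * harmonic_sum (Suc p) n u v t) (at t)"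
proof -
  have c: "cos (x + real (Suc p) * pi / 2) = - sin (x + real p * pi / 2)"
          "sin (x + real (Suc p) * pi / 2) = cos (x + real p * pi / 2)" for x
  proof -
    have "x + real (Suc p) * pi / 2 = (x + real p * pi / 2) + pi / 2"
      by (simp add: field_simps)
    then show "cos (x + real (Suc p) * pi / 2) = - sin (x + real p * pi / 2)"
          "sin (x + real (Suc p) * pi / 2) = cos (x + real p * pi / 2)"
      by (simp_all only: cos_add[of _ "pi / 2"] sin_add[of _ "pi / 2"] cos_pi_half sin_pi_half)
  qed
  show ?thesis
    unfolding harmonic_sum_def c using assms
    by (auto intro!: derivative_eq_intros sum.cong simp: sum_distrib_left field_simps)
qed

lemma harmonic_sum_2pi: "harmonic_sum p n u v (2 * pi) = harmonic_sum p n u v 0"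
proof -
  have "cos (real k * (2*pi) + c) = cos c" "sin (real k * (2*pi) + c) = sin c" for k c
    using sin_2npi[of k] cos_2npi[of k] by (simp_all add: sin_add cos_add mult_ac)
  then show ?thesis by (simp add: harmonic_sum_def)
qed

lemma PX_sum_harmonics_sq:
  fixes \<alpha> \<beta> :: "nat \<Rightarrow> real"
  shows "(\<integral>t. (\<Sum>k=1..n. \<alpha> k * cos (real k * t + \<theta>) + \<beta> k * sin (real k * t + \<theta>))\<^sup>2 \<partial>PX)
         = (\<Sum>k=1..n. (\<alpha> k)\<^sup>2 + (\<beta> k)\<^sup>2) / 2"
proof -
  define h where "h k t = \<alpha> k * cos (real k * t + \<theta>) + \<beta> k * sin (real k * t + \<theta>)" for k t
  have "continuous_on UNIV (h k)" for k
    unfolding h_def by (intro continuous_intros)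
  then have int: "integrable PX (\<lambda>t. h k t * h l t)" for k l
    by (intro PX_integrable_continuous continuous_intros)
  have "(\<integral>t. (\<Sum>k=1..n. h k t)\<^sup>2 \<partial>PX) = (\<Sum>k=1..n. \<Sum>l=1..n. \<integral>t. h k t * h l t \<partial>PX)"
    using int by (simp add: power2_eq_square sum_product integral_sum)
  also have "\<dots> = (\<Sum>k=1..n. \<Sum>l=1..n. if k = l then (\<alpha> k * \<alpha> l + \<beta> k * \<beta> l) / 2 else 0)"
    unfolding h_def by (intro sum.cong refl PX_harmonic_product) auto
  also have "\<dots> = (\<Sum>k=1..n. ((\<alpha> k)\<^sup>2 + (\<beta> k)\<^sup>2) / 2)"
    by (intro sum.cong refl) (simp add: power2_eq_square)
  finally show ?thesis by (simp add: h_def sum_divide_distrib)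
qed

lemma PX_harmonic_sum_sq:
  "(\<integral>t. (harmonic_sum p n u v t)\<^sup>2 \<partial>PX)
   = (\<Sum>k=1..n. (real k / real n) ^ (2 * p) * ((u k)\<^sup>2 + (v k)\<^sup>2)) / (2 * real n)"
proof -
  have "(\<integral>t. (harmonic_sum p n u v t)\<^sup>2 \<partial>PX) = (1 / real n) * (\<integral>t. (\<Sum>k=1..n.
     ((real k / real n) ^ p * u k) * cos (real k * t + real p * pi / 2)
     + ((real k / real n) ^ p * v k) * sin (real k * t + real p * pi / 2))\<^sup>2 \<partial>PX)"
    by (simp add: harmonic_sum_def power_mult_distrib power_divide field_simps
        flip: integral_mult_right_zero)
  also have "\<dots> = (1 / real n) * ((\<Sum>k=1..n. (((real k / real n) ^ p * u k))\<^sup>2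
      + ((real k / real n) ^ p * v k)\<^sup>2) / 2)"
    by (subst PX_sum_harmonics_sq) simp
  also have "(\<Sum>k=1..n. (((real k / real n) ^ p * u k))\<^sup>2 + ((real k / real n) ^ p * v k)\<^sup>2)
    = (\<Sum>k=1..n. (real k / real n) ^ (2 * p) * ((u k)\<^sup>2 + (v k)\<^sup>2))"
    by (intro sum.cong refl) (simp add: power_mult_distrib power_mult [symmetric] algebra_simps)
  finally show ?thesis by simp
qed

lemma PX_harmonic_sum_sq_le:
  "(\<integral>t. (harmonic_sum p n u v t)\<^sup>2 \<partial>PX) \<le> (\<Sum>k=1..n. (u k)\<^sup>2 + (v k)\<^sup>2) / (2 * real n)"
  unfolding PX_harmonic_sum_sq
  by (intro divide_right_mono sum_mono mult_left_le_one_le power_le_one) auto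

text \<open>Cauchy-Schwarz against the constant 1, read off from the nonnegativity of a
  variance.\<close>

lemma PX_abs_integral_le_sqrt:
  fixes f :: "real \<Rightarrow> real"
  assumes "continuous_on UNIV f"
  shows "(\<integral>x. \<bar>f x\<bar> \<partial>PX) \<le> sqrt (\<integral>x. (f x)\<^sup>2 \<partial>PX)"
proof (rule real_le_rsqrt)
  have i: "integrable PX (\<lambda>x. \<bar>f x\<bar>)" "integrable PX (\<lambda>x. \<bar>f x\<bar>\<^sup>2)"
    using assms by (auto intro!: PX_integrable_continuous continuous_intros)
  have "0 \<le> PX.variance (\<lambda>x. \<bar>f x\<bar>)"
    by (rule PX.variance_positive)
  also have "\<dots> = (\<integral>x. (f x)\<^sup>2 \<partial>PX) - (\<integral>x. \<bar>f x\<bar> \<partial>PX)\<^sup>2"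
    using i by (subst PX.variance_eq) auto
  finally show "(\<integral>x. \<bar>f x\<bar> \<partial>PX)\<^sup>2 \<le> (\<integral>x. (f x)\<^sup>2 \<partial>PX)" by simp
qed

text \<open>The weight \<open>D / (D\<^sup>2 + \<epsilon>)\<close> is a regularised inverse of the derivative, so that the
  boundary-free integration by parts costs nothing where \<open>D\<close> vanishes.\<close>
lemma PX_integration_by_parts:
  fixes F D S \<psi> g :: "real \<Rightarrow> real"
  assumes m: "m > 0" and \<epsilon>: "\<epsilon> > 0"
    and F: "\<And>t. (F has_real_derivative m * D t) (at t)"
    and D: "\<And>t. (D has_real_derivative m * S t) (at t)"
    and S: "continuous_on UNIV S"
    and per: "F (2*pi) = F 0" "D (2*pi) = D 0"
    and \<psi>: "\<And>x. (\<psi> has_real_derivative g x) (at x)"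
    and g: "continuous_on UNIV g"
    and \<psi>_le: "\<And>x. \<bar>\<psi> x\<bar> \<le> h" and g_le: "\<And>x. \<bar>g x\<bar> \<le> C"
  shows "\<bar>\<integral>t. g (F t) \<partial>PX\<bar> \<le> h / \<epsilon> * (\<integral>t. \<bar>S t\<bar> \<partial>PX) + C * (\<integral>t. \<epsilon> / ((D t)\<^sup>2 + \<epsilon>) \<partial>PX)"
proof -
  have cF: "continuous_on UNIV F" and cD: "continuous_on UNIV D" and c\<psi>: "continuous_on UNIV \<psi>"
    using F D \<psi> by (meson DERIV_isCont continuous_at_imp_continuous_on)+
  have cgF: "continuous_on UNIV (\<lambda>t. g (F t))" and c\<psi>F: "continuous_on UNIV (\<lambda>t. \<psi> (F t))"
    using continuous_on_compose2[OF g cF] continuous_on_compose2[OF c\<psi> cF] by auto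
  have pos: "(D t)\<^sup>2 + \<epsilon> > 0" for t
    using \<epsilon> by (simp add: add_nonneg_pos)
  note nz = pos[THEN less_imp_neq, symmetric]
  define A where "A t = g (F t) * ((D t)\<^sup>2 / ((D t)\<^sup>2 + \<epsilon>))" for t
  define B where "B t = \<psi> (F t) * (S t * (\<epsilon> - (D t)\<^sup>2) / ((D t)\<^sup>2 + \<epsilon>)\<^sup>2)" for t
  define E where "E t = g (F t) * (\<epsilon> / ((D t)\<^sup>2 + \<epsilon>))" for t
  have cA: "continuous_on UNIV A" and cB: "continuous_on UNIV B" and cE: "continuous_on UNIV E"
    unfolding A_def B_def E_def using nz
    by (intro continuous_intros cgF c\<psi>F cD S; simp)+
  note int = cA[THEN PX_integrable_continuous] cB[THEN PX_integrable_continuous]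
    cE[THEN PX_integrable_continuous]
  have \<psi>F: "((\<lambda>t. \<psi> (F t)) has_real_derivative g (F t) * (m * D t)) (at t)" for t
    using DERIV_chain2[OF \<psi> F] .
  \<comment> \<open>The left side is the derivative in the shape in which the quotient rule delivers
    it, with \<open>x\<close>, \<open>d\<close>, \<open>s\<close>, \<open>p\<close> standing for
    \<open>g (F t)\<close>, \<open>D t\<close>, \<open>S t\<close>,
    \<open>\<psi> (F t)\<close>.\<close>
  have alg: "((x * (m * d) * d + m * s * p) * ((d\<^sup>2 + \<epsilon>) * m) - p * d * (2 * (m * s * d) * m))
      / ((d\<^sup>2 + \<epsilon>) * m * ((d\<^sup>2 + \<epsilon>) * m))
      = x * d\<^sup>2 / (d\<^sup>2 + \<epsilon>) + p * (s * (\<epsilon> - d\<^sup>2)) / (d\<^sup>2 + \<epsilon>)\<^sup>2" for x d s p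
  proof -
    define q where "q = d\<^sup>2 + \<epsilon>"
    have q: "q > 0" unfolding q_def using \<epsilon> by (simp add: add_nonneg_pos)
    have e: "\<epsilon> - d\<^sup>2 = q - 2 * d\<^sup>2" by (simp add: q_def)
    show ?thesis
      unfolding q_def[symmetric] e using q m
      by (simp add: divide_simps) (simp add: algebra_simps power2_eq_square)
  qed
  \<comment> \<open>Division by \<open>m\<close> absorbs the factor of \<open>F' = m D\<close> and
    of \<open>D' = m S\<close>, so neither \<open>A\<close> nor \<open>B\<close> contains
    \<open>m\<close>.\<close>
  have "((\<lambda>t. \<psi> (F t) * (D t / ((D t)\<^sup>2 + \<epsilon>)) / m) has_real_derivative A t + B t) (at t)" for t
    unfolding A_def B_def using m nz
    by (auto intro!: derivative_eq_intros \<psi>F D intro: alg)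
  \<comment> \<open>The derivative of a \<open>2 * pi\<close>-periodic function has mean zero, so
    there is no boundary term.\<close>
  then have "(\<integral>t. A t + B t \<partial>PX) = 0"
    using cA cB
    by (subst PX_integral_FTC[where F="\<lambda>t. \<psi> (F t) * (D t / ((D t)\<^sup>2 + \<epsilon>)) / m"])
      (auto intro: continuous_intros simp: per)
  then have AB: "(\<integral>t. A t \<partial>PX) = - (\<integral>t. B t \<partial>PX)"
    using int by simp
  \<comment> \<open>\<open>A\<close> is the part of \<open>g (F t)\<close> that partial integration
    reaches; \<open>E\<close> is the loss due to the regularisation, sizeable only where
    \<open>D\<close> is small.\<close>
  have "g (F t) = A t + E t" for t
    using nz[of t] by (simp add: A_def E_def flip: distrib_left add_divide_distrib)
  then have "(\<integral>t. g (F t) \<partial>PX) = (\<integral>t. E t \<partial>PX) - (\<integral>t. B t \<partial>PX)"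
    using int AB by simp
  also have "\<bar>\<dots>\<bar> \<le> (\<integral>t. \<bar>E t\<bar> \<partial>PX) + (\<integral>t. \<bar>B t\<bar> \<partial>PX)"
    using integral_abs_bound[of PX E] integral_abs_bound[of PX B] by linarith
  also have "(\<integral>t. \<bar>E t\<bar> \<partial>PX) \<le> (\<integral>t. C * (\<epsilon> / ((D t)\<^sup>2 + \<epsilon>)) \<partial>PX)"
  proof (rule integral_mono)
    show "integrable PX (\<lambda>t. C * (\<epsilon> / ((D t)\<^sup>2 + \<epsilon>)))"
      using nz by (intro PX_integrable_continuous continuous_intros cD) auto
    show "\<bar>E t\<bar> \<le> C * (\<epsilon> / ((D t)\<^sup>2 + \<epsilon>))" for t
      unfolding E_def abs_mult using g_le[of "F t"] pos[of t] \<epsilon>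
      by (intro mult_mono) (auto simp: abs_mult)
  qed (use int in auto)
  also have "(\<integral>t. \<bar>B t\<bar> \<partial>PX) \<le> (\<integral>t. h / \<epsilon> * \<bar>S t\<bar> \<partial>PX)"
  proof (rule integral_mono)
    show "integrable PX (\<lambda>t. h / \<epsilon> * \<bar>S t\<bar>)"
      by (intro PX_integrable_continuous continuous_intros S)
    fix t
    \<comment> \<open>One factor of the squared denominator absorbs the numerator, the other is at
      least \<epsilon>.\<close>
    have "\<bar>\<epsilon> - (D t)\<^sup>2\<bar> \<le> (D t)\<^sup>2 + \<epsilon>" using \<epsilon> by (auto simp: abs_le_iff)
    then have "\<bar>\<epsilon> - (D t)\<^sup>2\<bar> * \<epsilon> \<le> ((D t)\<^sup>2 + \<epsilon>) * ((D t)\<^sup>2 + \<epsilon>)"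
      using \<epsilon> by (intro mult_mono) auto
    then have q: "\<bar>\<epsilon> - (D t)\<^sup>2\<bar> / ((D t)\<^sup>2 + \<epsilon>)\<^sup>2 \<le> 1 / \<epsilon>"
      using \<epsilon> pos[of t] by (simp add: divide_simps power2_eq_square)
    have "\<bar>B t\<bar> = \<bar>\<psi> (F t)\<bar> * (\<bar>S t\<bar> * (\<bar>\<epsilon> - (D t)\<^sup>2\<bar> / ((D t)\<^sup>2 + \<epsilon>)\<^sup>2))"
      by (simp add: B_def abs_mult)
    also have "\<dots> \<le> h * (\<bar>S t\<bar> * (1 / \<epsilon>))"
      using \<psi>_le[of "F t"] q by (intro mult_mono) auto
    finally show "\<bar>B t\<bar> \<le> h / \<epsilon> * \<bar>S t\<bar>" by simp
  qed (use int in auto)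
  finally show ?thesis
    by (simp only: integral_mult_right_zero add.commute)
qed

subsection \<open>Smoothing and test functions\<close>

lemma ex_antiderivative:
  fixes \<phi> :: "real \<Rightarrow> real"
  assumes "continuous_on UNIV \<phi>"
  obtains \<Phi> where "\<And>x. (\<Phi> has_real_derivative \<phi> x) (at x)"
proof -
  have "\<And>x. isCont \<phi> x"
    using assms by (simp add: continuous_on_eq_continuous_at)
  then have "\<exists>\<Phi>. \<forall>x. (\<Phi> has_vector_derivative \<phi> x) (at x)"
    using einterval_antiderivative[of "-\<infinity>" "\<infinity>" \<phi>] by simp
  then obtain \<Phi> where "\<forall>x. (\<Phi> has_vector_derivative \<phi> x) (at x)" by blast
  then show thesis
    by (intro that[of \<Phi>]) (simp add: has_real_derivative_iff_has_vector_derivative)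
qed

text \<open>\<open>\<phi>'\<close> is the average of \<phi> over \<open>[x, x + h]\<close>, and the
  antiderivative of the difference is explicit: \<Phi> minus its own average over that interval.
  Since \<Phi> is 1-Lipschitz, this antiderivative is at most \<open>h\<close>, and the difference
  quotient \<open>\<phi>'\<close> has Lipschitz constant \<open>2 / h\<close>.\<close>

lemma Lipschitz_smoothing:
  fixes \<phi> :: "real \<Rightarrow> real"
  assumes cont: "continuous_on UNIV \<phi>" and le: "\<And>x. \<bar>\<phi> x\<bar> \<le> 1" and h: "h > 0"
  obtains \<phi>' \<psi> where "\<And>x. \<bar>\<phi>' x\<bar> \<le> 1" "\<And>x y. \<bar>\<phi>' x - \<phi>' y\<bar> \<le> 2 / h * \<bar>x - y\<bar>"
    "continuous_on UNIV \<phi>'"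
    "\<And>x. (\<psi> has_real_derivative \<phi> x - \<phi>' x) (at x)" "\<And>x. \<bar>\<psi> x\<bar> \<le> h"
proof -
  obtain \<Phi> where \<Phi>: "\<And>x. (\<Phi> has_real_derivative \<phi> x) (at x)"
    by (rule ex_antiderivative[OF cont]) blast
  have c\<Phi>: "continuous_on UNIV \<Phi>"
    using \<Phi> by (meson DERIV_isCont continuous_at_imp_continuous_on)
  obtain \<Psi> where \<Psi>: "\<And>x. (\<Psi> has_real_derivative \<Phi> x) (at x)"
    by (rule ex_antiderivative[OF c\<Phi>]) blast
  have L: "\<bar>\<Phi> x - \<Phi> y\<bar> \<le> \<bar>x - y\<bar>" for x y
    using field_differentiable_bound[of UNIV \<Phi> \<phi> 1 x y] \<Phi> le by simp
  define \<phi>' where "\<phi>' x = (\<Phi> (x + h) - \<Phi> x) / h" for x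
  define \<psi> where "\<psi> x = \<Phi> x - (\<Psi> (x + h) - \<Psi> x) / h" for x
  have Psi_shift: "((\<lambda>x. \<Psi> (x + h)) has_real_derivative \<Phi> (x + h)) (at x)" for x
    using \<Psi>[of "x + h"] by (simp add: DERIV_shift)
  show thesis
  proof
    show "\<bar>\<phi>' x\<bar> \<le> 1" for x
      using L[of "x + h" x] h by (simp add: \<phi>'_def)
    show "\<bar>\<phi>' x - \<phi>' y\<bar> \<le> 2 / h * \<bar>x - y\<bar>" for x y
    proof -
      have "\<phi>' x - \<phi>' y = ((\<Phi> (x + h) - \<Phi> (y + h)) - (\<Phi> x - \<Phi> y)) / h"
        by (simp add: \<phi>'_def diff_divide_distrib)
      also have "\<bar>\<dots>\<bar> \<le> (2 * \<bar>x - y\<bar>) / h"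
        unfolding abs_divide using h L[of "x + h" "y + h"] L[of x y]
          abs_triangle_ineq4[of "\<Phi> (x + h) - \<Phi> (y + h)" "\<Phi> x - \<Phi> y"]
        by (intro frac_le) simp_all
      finally show ?thesis by simp
    qed
    show "continuous_on UNIV \<phi>'"
      unfolding \<phi>'_def using h
      by (intro continuous_intros c\<Phi> continuous_on_compose2[OF c\<Phi>]) auto
    show "(\<psi> has_real_derivative \<phi> x - \<phi>' x) (at x)" for x
      unfolding \<psi>_def \<phi>'_def using h by (auto intro!: derivative_eq_intros \<Phi> \<Psi> Psi_shift)
    show "\<bar>\<psi> x\<bar> \<le> h" for x
    proof -
      \<comment> \<open>Mean value bound for \<open>\<Psi> y - \<Phi> x * y\<close> on
        \<open>[x, x + h]\<close>: the derivative is at most \<open>h\<close> there, and the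
        increment is \<open>- (h * \<psi> x)\<close>.\<close>
      have "\<bar>(\<Psi> (x + h) - \<Phi> x * (x + h)) - (\<Psi> x - \<Phi> x * x)\<bar> \<le> h * \<bar>(x + h) - x\<bar>"
        unfolding real_norm_def[symmetric]
      proof (rule field_differentiable_bound[where S="{x..x+h}" and f'="\<lambda>y. \<Phi> y - \<Phi> x"])
        show "((\<lambda>y. \<Psi> y - \<Phi> x * y) has_real_derivative \<Phi> y - \<Phi> x) (at y within {x..x+h})" for y
          by (rule has_field_derivative_at_within) (auto intro!: derivative_eq_intros \<Psi>)
        show "norm (\<Phi> y - \<Phi> x) \<le> h" if "y \<in> {x..x+h}" for y
          using L[of y x] that by auto
      qed (use h in auto)
      also have "(\<Psi> (x + h) - \<Phi> x * (x + h)) - (\<Psi> x - \<Phi> x * x) = - (h * \<psi> x)"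
        using h by (simp add: \<psi>_def field_simps)
      finally show ?thesis
        using h by (simp add: abs_mult)
    qed
  qed
qed

text \<open>Regularity gives a closed set inside \<open>A\<close> and an open set around it with
  small gap; a Urysohn function between them differs from the indicator only in the gap. One
  function has to serve both measures, because later two integrals of the same test function are
  compared.\<close>

lemma continuous_approx_indicator:
  fixes \<mu> \<nu> :: "real measure"
  assumes \<mu>: "finite_borel_measure \<mu>" and \<nu>: "finite_borel_measure \<nu>"
    and A: "A \<in> sets borel" and e: "e > 0"
  obtains \<psi> where "continuous_on UNIV \<psi>" "\<And>x. \<bar>\<psi> x\<bar> \<le> (1::real)"
    "(\<integral>x. \<bar>indicator A x - \<psi> x\<bar> \<partial>\<mu>) < e" "(\<integral>x. \<bar>indicator A x - \<psi> x\<bar> \<partial>\<nu>) < e"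
proof -
  have regular: "\<exists>K U. K \<subseteq> A \<and> A \<subseteq> U \<and> closed K \<and> open U \<and> measure \<rho> (U - K) < e"
    if "finite_borel_measure \<rho>" for \<rho> :: "real measure"
  proof -
    interpret finite_borel_measure \<rho> by fact
    have [simp]: "emeasure \<rho> X = ennreal (measure \<rho> X)" for X
      by (rule emeasure_eq_measure)
    have meas: "X \<in> sets \<rho>" if "X \<in> sets borel" for X
      using that by (simp add: M_is_borel)
    have "ennreal (measure \<rho> A) < ennreal (measure \<rho> A + e/2)" using e by (simp add: ennreal_less_iff)
    then have "(INF U\<in>{U. A \<subseteq> U \<and> open U}. emeasure \<rho> U) < ennreal (measure \<rho> A + e/2)"
      using outer_regular[of \<rho> A] A M_is_borel by simp
    then obtain U where U: "A \<subseteq> U" "open U" "ennreal (measure \<rho> U) < ennreal (measure \<rho> A + e/2)"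
      unfolding INF_less_iff by (auto simp del: ennreal_plus)
    then have less: "measure \<rho> U < measure \<rho> A + e/2"
      by (meson ennreal_leI not_le)
    have "\<exists>K. K \<subseteq> A \<and> closed K \<and> measure \<rho> A - e/2 < measure \<rho> K"
    \<comment> \<open>\<open>ennreal\<close> truncates negative numbers to 0, so the strict
      inequality needed for inner regularity fails for a null set; there the empty set does.\<close>
    proof (cases "measure \<rho> A = 0")
      case True then show ?thesis using e by (intro exI[of _ "{}"]) auto
    next
      case False
      then have "ennreal (measure \<rho> A - e/2) < ennreal (measure \<rho> A)"
        using e by (intro ennreal_lessI) (auto simp: zero_less_measure_iff)
      then have "ennreal (measure \<rho> A - e/2) < (SUP K\<in>{K. K \<subseteq> A \<and> compact K}. emeasure \<rho> K)"
        using inner_regular[of \<rho> A] A M_is_borel by simp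
      then obtain K where "K \<subseteq> A" "compact K" "ennreal (measure \<rho> A - e/2) < ennreal (measure \<rho> K)"
        unfolding less_SUP_iff by auto
      moreover from this have "measure \<rho> A - e/2 < measure \<rho> K"
        by (meson ennreal_leI not_le)
      ultimately show ?thesis
        by (intro exI[of _ K]) (simp add: compact_imp_closed)
    qed
    then obtain K where K: "K \<subseteq> A" "closed K" "measure \<rho> A - e/2 < measure \<rho> K" by auto
    have "measure \<rho> (U - K) = measure \<rho> U - measure \<rho> K"
      using U K by (intro finite_measure_Diff meas) auto
    then show ?thesis using U less K by (intro exI[of _ K] exI[of _ U]) auto
  qed
  obtain K1 U1 where 1: "K1 \<subseteq> A" "A \<subseteq> U1" "closed K1" "open U1" "measure \<mu> (U1 - K1) < e"
    using regular[OF \<mu>] by auto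
  obtain K2 U2 where 2: "K2 \<subseteq> A" "A \<subseteq> U2" "closed K2" "open U2" "measure \<nu> (U2 - K2) < e"
    using regular[OF \<nu>] by auto
  \<comment> \<open>Enlarging the closed set and shrinking the open one keeps the gap small for both
    measures at once.\<close>
  define K U where "K = K1 \<union> K2" and "U = U1 \<inter> U2"
  have "closed K" "closed (- U)" "K \<inter> - U = {}"
    using 1 2 by (auto simp: K_def U_def)
  then obtain \<psi> :: "real \<Rightarrow> real" where \<psi>: "continuous_on UNIV \<psi>" "\<And>x. \<psi> x \<in> closed_segment 1 0"
    "\<And>x. x \<in> K \<Longrightarrow> \<psi> x = 1" "\<And>x. x \<in> - U \<Longrightarrow> \<psi> x = 0"
    by (rule Urysohn[where a=1 and b=0]) (rule that)
  have range: "0 \<le> \<psi> x" "\<psi> x \<le> 1" for x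
    using \<psi>(2)[of x] by (auto simp: closed_segment_eq_real_ivl)
  have [measurable]: "\<psi> \<in> borel_measurable borel"
    using \<psi>(1) by (rule borel_measurable_continuous_onI)
  have bound: "(\<integral>x. \<bar>indicator A x - \<psi> x\<bar> \<partial>\<rho>) \<le> measure \<rho> (U - K)"
    if "finite_borel_measure \<rho>" for \<rho> :: "real measure"
  proof -
    interpret finite_borel_measure \<rho> by fact
    note [measurable_cong] = M_is_borel
    have sets: "A \<in> sets \<rho>" "U - K \<in> sets \<rho>"
      using A 1 2 by (auto simp: U_def K_def M_is_borel)
    have "(\<integral>x. \<bar>indicator A x - \<psi> x\<bar> \<partial>\<rho>) \<le> (\<integral>x. indicator (U - K) x \<partial>\<rho>)"
    proof (rule integral_mono)
      show "integrable \<rho> (\<lambda>x. \<bar>indicator A x - \<psi> x\<bar>)"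
        using sets range by (intro integrable_const_bound[where B=1])
          (auto split: split_indicator)
      show "integrable \<rho> (indicator (U - K) :: real \<Rightarrow> real)"
        using sets by (simp add: integrable_indicator_iff emeasure_eq_measure)
      show "\<bar>indicator A x - \<psi> x\<bar> \<le> indicator (U - K) x" for x
        using range[of x] \<psi>(3)[of x] \<psi>(4)[of x] 1 2
        by (auto split: split_indicator simp: K_def U_def)
    qed
    then show ?thesis by (simp add: Int_absorb2[OF sets.sets_into_space[OF sets(2)]])
  qed
  have mono: "measure \<rho> (U - K) \<le> measure \<rho> (U' - K')"
    if "finite_borel_measure \<rho>" "open U'" "closed K'" "U \<subseteq> U'" "K' \<subseteq> K"
    for \<rho> :: "real measure" and U' K'
  proof -
    interpret finite_borel_measure \<rho> by fact
    show ?thesis using that \<open>closed K\<close> \<open>closed (- U)\<close>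
      by (intro finite_measure_mono) (auto simp: M_is_borel)
  qed
  show thesis
  proof
    show "(\<integral>x. \<bar>indicator A x - \<psi> x\<bar> \<partial>\<mu>) < e"
      using bound[OF \<mu>] mono[OF \<mu>, of U1 K1] 1 by (auto simp: K_def U_def)
    show "(\<integral>x. \<bar>indicator A x - \<psi> x\<bar> \<partial>\<nu>) < e"
      using bound[OF \<nu>] mono[OF \<nu>, of U2 K2] 2 by (auto simp: K_def U_def)
    show "\<bar>\<psi> x\<bar> \<le> 1" for x
      using range[of x] by simp
  qed (rule \<psi>(1))
qed

lemma (in finite_borel_measure) integrable_continuous_bounded:
  fixes \<psi> :: "real \<Rightarrow> real"
  assumes "continuous_on UNIV \<psi>" "\<And>x. \<bar>\<psi> x\<bar> \<le> B"
  shows "integrable M \<psi>"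
  using assms borel_measurable_continuous_onI[of \<psi>]
  by (intro integrable_const_bound[where B=B])
    (auto simp: measurable_cong_sets[OF M_is_borel refl])

text \<open>Density of bounded continuous functions in L1, for two measures simultaneously. The
  bound \<open>B\<close> on the approximant is arbitrary; it is brought back to 1 by clipping when
  the lemma is applied.\<close>

lemma continuous_approx_borel:
  fixes \<mu> \<nu> :: "real measure" and \<phi> :: "real \<Rightarrow> real"
  assumes \<mu>: "finite_borel_measure \<mu>" and \<nu>: "finite_borel_measure \<nu>"
    and meas: "\<phi> \<in> borel_measurable borel" and nonneg: "\<And>x. 0 \<le> \<phi> x" and le: "\<And>x. \<phi> x \<le> C"
    and e: "e > 0"
  shows "\<exists>\<psi> B. continuous_on UNIV \<psi> \<and> (\<forall>x. \<bar>\<psi> x\<bar> \<le> B) \<and>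
    (\<integral>x. \<bar>\<phi> x - \<psi> x\<bar> \<partial>\<mu>) < e \<and> (\<integral>x. \<bar>\<phi> x - \<psi> x\<bar> \<partial>\<nu>) < e"
proof -
  interpret \<mu>: finite_borel_measure \<mu> by fact
  interpret \<nu>: finite_borel_measure \<nu> by fact
  note [measurable_cong] = \<mu>.M_is_borel \<nu>.M_is_borel
  define approx where "approx e f \<psi> \<longleftrightarrow> (\<integral>x. \<bar>f x - \<psi> x\<bar> \<partial>\<mu>) < e \<and> (\<integral>x. \<bar>f x - \<psi> x\<bar> \<partial>\<nu>) < e"
    for e and f \<psi> :: "real \<Rightarrow> real"
  define test where "test \<psi> \<longleftrightarrow> continuous_on UNIV \<psi> \<and> (\<exists>B. \<forall>x. \<bar>\<psi> x\<bar> \<le> B)" for \<psi> :: "real \<Rightarrow> real"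
  have test_int: "integrable \<mu> \<psi>" "integrable \<nu> \<psi>" if "test \<psi>" for \<psi>
    using that \<mu>.integrable_continuous_bounded \<nu>.integrable_continuous_bounded
    unfolding test_def by blast+
  have approx_trans: "approx (d + e) f \<psi>"
    if "approx d f g" "approx e g \<psi>" "integrable \<mu> f" "integrable \<nu> f"
      "integrable \<mu> g" "integrable \<nu> g" "integrable \<mu> \<psi>" "integrable \<nu> \<psi>" for d e f g \<psi>
  proof -
    have "(\<integral>x. \<bar>f x - \<psi> x\<bar> \<partial>\<rho>) \<le> (\<integral>x. \<bar>f x - g x\<bar> + \<bar>g x - \<psi> x\<bar> \<partial>\<rho>)"
      if "integrable \<rho> f" "integrable \<rho> g" "integrable \<rho> \<psi>" for \<rho>
      using that by (intro integral_mono) auto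
    from this[of \<mu>] this[of \<nu>] show ?thesis
      using that unfolding approx_def by auto
  qed
  \<comment> \<open>Integrability is a premise of the claim proved by induction, since of the
    functions met on the way only measurability and sign are known.\<close>
  have "integrable \<mu> \<phi> \<and> integrable \<nu> \<phi> \<longrightarrow> (\<forall>e>0. \<exists>\<psi>. test \<psi> \<and> approx e \<phi> \<psi>)"
    using meas nonneg
  proof (induction rule: borel_measurable_induct_real)
    case (set A)
    show ?case
    proof safe
      fix e :: real assume "e > 0"
      then obtain \<psi> where "continuous_on UNIV \<psi>" "\<And>x. \<bar>\<psi> x\<bar> \<le> 1" "approx e (indicator A) \<psi>"
        unfolding approx_def by (rule continuous_approx_indicator[OF \<mu> \<nu> set]) (blast intro: that)
      then show "\<exists>\<psi>. test \<psi> \<and> approx e (indicator A) \<psi>"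
        unfolding test_def by blast
    qed
  next
    case (mult u c)
    show ?case
    proof (cases "c = 0")
      case True
      then show ?thesis unfolding test_def approx_def
        by (auto intro!: exI[of _ "\<lambda>_. 0"])
    next
      case False
      with mult have "c > 0" by auto
      show ?thesis
      proof safe
        fix e :: real assume "e > 0" and int: "integrable \<mu> (\<lambda>x. c * u x)" "integrable \<nu> (\<lambda>x. c * u x)"
        with \<open>c > 0\<close> have "e / c > 0" "integrable \<mu> u" "integrable \<nu> u" by auto
        then obtain \<psi> where \<psi>: "test \<psi>" "approx (e / c) u \<psi>" using mult by metis
        have "\<bar>c * u x - c * \<psi> x\<bar> = c * \<bar>u x - \<psi> x\<bar>" for x
          using \<open>c > 0\<close> by (simp add: abs_mult flip: right_diff_distrib)
        then have "approx e (\<lambda>x. c * u x) (\<lambda>x. c * \<psi> x)"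
          using \<psi>(2) \<open>c > 0\<close> by (simp add: approx_def field_simps)
        moreover have "test (\<lambda>x. c * \<psi> x)"
          using \<psi>(1) unfolding test_def
          by (auto intro!: continuous_intros simp: abs_mult) (meson abs_ge_zero mult_left_mono)
        ultimately show "\<exists>\<psi>. test \<psi> \<and> approx e (\<lambda>x. c * u x) \<psi>" by auto
      qed
    qed
  next
    case (add u v)
    show ?case
    proof safe
      fix e :: real assume "e > 0" and int: "integrable \<mu> (\<lambda>x. v x + u x)" "integrable \<nu> (\<lambda>x. v x + u x)"
      have [measurable]: "u \<in> borel_measurable borel" "v \<in> borel_measurable borel"
        using add by auto
      have i: "integrable \<mu> u" "integrable \<nu> u" "integrable \<mu> v" "integrable \<nu> v"
        using add by (auto intro!: Bochner_Integration.integrable_bound[OF int(1)]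
            Bochner_Integration.integrable_bound[OF int(2)])
      with add \<open>e > 0\<close> obtain \<psi> \<psi>' where \<psi>: "test \<psi>" "approx (e/2) u \<psi>" "test \<psi>'" "approx (e/2) v \<psi>'"
        by (metis half_gt_zero)
      have "test (\<lambda>x. \<psi>' x + \<psi> x)"
        using \<psi>(1,3) unfolding test_def
        by (auto intro!: continuous_intros) (meson abs_triangle_ineq add_mono order_trans)
      moreover have "(\<integral>x. \<bar>(v x + u x) - (\<psi>' x + \<psi> x)\<bar> \<partial>\<rho>)
          \<le> (\<integral>x. \<bar>v x - \<psi>' x\<bar> + \<bar>u x - \<psi> x\<bar> \<partial>\<rho>)"
        if "integrable \<rho> u" "integrable \<rho> v" "integrable \<rho> \<psi>" "integrable \<rho> \<psi>'" for \<rho>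
        using that by (intro integral_mono) auto
      from this[of \<mu>] this[of \<nu>] have "approx e (\<lambda>x. v x + u x) (\<lambda>x. \<psi>' x + \<psi> x)"
        using \<psi> i test_int unfolding approx_def by auto
      ultimately show "\<exists>\<psi>. test \<psi> \<and> approx e (\<lambda>x. v x + u x) \<psi>" by auto
    qed
  next
    case (seq U)
    show ?case
    proof safe
      fix e :: real assume "e > 0" and int: "integrable \<mu> \<phi>" "integrable \<nu> \<phi>"
      have Ule: "U i x \<le> \<phi> x" for i x
        using seq.hyps(3,4) by (intro incseq_le) (auto simp: incseq_def le_fun_def)
      have [measurable]: "U i \<in> borel_measurable borel" "\<phi> \<in> borel_measurable borel" for i
        using seq.hyps(1) meas by auto
      have i: "integrable \<rho> (U i)" "(\<lambda>i. \<integral>x. \<bar>\<phi> x - U i x\<bar> \<partial>\<rho>) \<longlonglongrightarrow> 0"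
        if "integrable \<rho> \<phi>" and [measurable_cong]: "sets \<rho> = sets borel" for \<rho> i
      proof -
        show "integrable \<rho> (U i)"
          using seq.hyps(2) Ule nonneg by (intro Bochner_Integration.integrable_bound[OF that(1)]) auto
        have "(\<lambda>i. \<integral>x. \<bar>\<phi> x - U i x\<bar> \<partial>\<rho>) \<longlonglongrightarrow> (\<integral>x. 0 \<partial>\<rho>)"
        proof (rule integral_dominated_convergence[where w=\<phi>])
          show "AE x in \<rho>. (\<lambda>i. \<bar>\<phi> x - U i x\<bar>) \<longlonglongrightarrow> 0"
          proof (rule AE_I2)
            show "(\<lambda>i. \<bar>\<phi> x - U i x\<bar>) \<longlonglongrightarrow> 0" for x
              using tendsto_rabs[OF tendsto_diff[OF tendsto_const[of "\<phi> x"] seq.hyps(4)[of x]]]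
              by (simp add: meas)
          qed
          show "AE x in \<rho>. norm \<bar>\<phi> x - U i x\<bar> \<le> \<phi> x" for i
            using seq.hyps(2)[of i] Ule[of i] by auto
        qed (use that in auto)
        then show "(\<lambda>i. \<integral>x. \<bar>\<phi> x - U i x\<bar> \<partial>\<rho>) \<longlonglongrightarrow> 0" by simp
      qed
      have "\<forall>\<^sub>F i in sequentially. approx (e/2) \<phi> (U i)"
        unfolding approx_def using \<open>e > 0\<close> int
        by (intro eventually_conj order_tendstoD(2)[OF i(2)]) (auto simp: \<mu>.M_is_borel \<nu>.M_is_borel)
      then obtain n where n: "approx (e/2) \<phi> (U n)"
        by (auto simp: eventually_sequentially)
      have Un: "integrable \<mu> (U n)" "integrable \<nu> (U n)"
        using i(1) int \<mu>.M_is_borel \<nu>.M_is_borel by auto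
      then obtain \<psi> where "test \<psi>" "approx (e/2) (U n) \<psi>"
        using seq.IH[of n] \<open>e > 0\<close> by (metis half_gt_zero)
      then show "\<exists>\<psi>. test \<psi> \<and> approx e \<phi> \<psi>"
        using approx_trans[OF n, of "e/2" \<psi>] int Un test_int[of \<psi>] by auto
    qed
  qed
  moreover have "integrable \<mu> \<phi>" "integrable \<nu> \<phi>"
    using meas nonneg le
    by (auto intro!: \<mu>.integrable_const_bound[where B=C] \<nu>.integrable_const_bound[where B=C])
  ultimately show ?thesis
    using e unfolding test_def approx_def by blast
qed

lemma borel_test_le_continuous_test:
  fixes \<mu> \<nu> :: "real measure" and \<phi> :: "real \<Rightarrow> real"
  assumes \<mu>: "real_distribution \<mu>" and \<nu>: "real_distribution \<nu>"
    and test: "\<And>\<psi>. continuous_on UNIV \<psi> \<Longrightarrow> (\<And>x. \<bar>\<psi> x\<bar> \<le> (1::real)) \<Longrightarrow>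
      (\<integral>x. \<psi> x \<partial>\<mu>) - (\<integral>x. \<psi> x \<partial>\<nu>) \<le> d"
    and [measurable]: "\<phi> \<in> borel_measurable borel" and le: "\<And>x. \<bar>\<phi> x\<bar> \<le> 1"
  shows "(\<integral>x. \<phi> x \<partial>\<mu>) - (\<integral>x. \<phi> x \<partial>\<nu>) \<le> d"
proof (rule field_le_epsilon)
  fix e :: real assume "e > 0"
  interpret \<mu>: real_distribution \<mu> by fact
  interpret \<nu>: real_distribution \<nu> by fact
  have fb: "finite_borel_measure \<mu>" "finite_borel_measure \<nu>" by unfold_locales
  \<comment> \<open>The shift by 1 makes the function nonnegative, as the approximation
    requires.\<close>
  have "0 \<le> \<phi> x + 1" "\<phi> x + 1 \<le> 2" for x
    using le[of x] by (auto simp: abs_le_iff)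
  then obtain \<psi>0 B where \<psi>0: "continuous_on UNIV \<psi>0" "\<And>x. \<bar>\<psi>0 x\<bar> \<le> B"
    "(\<integral>x. \<bar>(\<phi> x + 1) - \<psi>0 x\<bar> \<partial>\<mu>) < e/2" "(\<integral>x. \<bar>(\<phi> x + 1) - \<psi>0 x\<bar> \<partial>\<nu>) < e/2"
    using continuous_approx_borel[OF fb, of "\<lambda>x. \<phi> x + 1" 2 "e/2"] \<open>e > 0\<close> by auto
  \<comment> \<open>Clipping to \<open>[-1, 1]\<close>, where \<phi> takes its values, makes the
    approximant an admissible test and can only bring it closer to \<phi>.\<close>
  define \<psi> where "\<psi> x = max (-1) (min 1 (\<psi>0 x - 1))" for x
  have \<psi>: "continuous_on UNIV \<psi>" "\<And>x. \<bar>\<psi> x\<bar> \<le> 1"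
    unfolding \<psi>_def using \<psi>0(1) by (auto intro!: continuous_intros)
  have close: "\<bar>\<phi> x - \<psi> x\<bar> \<le> \<bar>(\<phi> x + 1) - \<psi>0 x\<bar>" for x
    using le[of x] unfolding \<psi>_def by (auto simp: max_def min_def)
  have diff: "\<bar>(\<integral>x. \<phi> x \<partial>\<rho>) - (\<integral>x. \<psi> x \<partial>\<rho>)\<bar> \<le> (\<integral>x. \<bar>(\<phi> x + 1) - \<psi>0 x\<bar> \<partial>\<rho>)"
    if "real_distribution \<rho>" for \<rho>
  proof -
    interpret real_distribution \<rho> by fact
    have i: "integrable \<rho> \<phi>" "integrable \<rho> \<psi>" "integrable \<rho> \<psi>0"
      using le integrable_continuous_bounded[OF \<psi>] integrable_continuous_bounded[OF \<psi>0(1,2)]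
      by (auto intro!: integrable_const_bound[where B=1])
    then have "\<bar>(\<integral>x. \<phi> x \<partial>\<rho>) - (\<integral>x. \<psi> x \<partial>\<rho>)\<bar> \<le> (\<integral>x. \<bar>\<phi> x - \<psi> x\<bar> \<partial>\<rho>)"
      using integral_abs_bound[of \<rho> "\<lambda>x. \<phi> x - \<psi> x"] by simp
    also have "\<dots> \<le> (\<integral>x. \<bar>(\<phi> x + 1) - \<psi>0 x\<bar> \<partial>\<rho>)"
      using i close by (intro integral_mono) auto
    finally show ?thesis .
  qed
  show "(\<integral>x. \<phi> x \<partial>\<mu>) - (\<integral>x. \<phi> x \<partial>\<nu>) \<le> d + e"
    using diff[OF \<mu>] diff[OF \<nu>] test[OF \<psi>] \<psi>0(3,4) by linarith
qed

subsection \<open>Total variation from convergence in law\<close>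

text \<open>Weak convergence handles one test function at a time, but the smoothed function varies
  with the test and the threshold for \<open>n\<close> must not. A Skorohod coupling gives
  uniformity: the expectation of \<open>min 2 (L * \<bar>Z n x - Y x\<bar>)\<close> bounds the error
  for all of them and tends to 0.\<close>

lemma uniform_Lipschitz_convergence:
  fixes \<mu> :: "nat \<Rightarrow> real measure" and \<nu> :: "real measure"
  assumes \<mu>: "\<And>n. real_distribution (\<mu> n)" and \<nu>: "real_distribution \<nu>"
    and conv: "weak_conv_m \<mu> \<nu>" and L: "L \<ge> 0" and d: "d > 0"
  shows "\<forall>\<^sub>F n in sequentially. \<forall>\<phi>. (\<forall>x. \<bar>\<phi> x\<bar> \<le> 1) \<longrightarrow> (\<forall>x y. \<bar>\<phi> x - \<phi> y\<bar> \<le> L * \<bar>x - y\<bar>)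
    \<longrightarrow> continuous_on UNIV \<phi> \<longrightarrow> \<bar>(\<integral>x. \<phi> x \<partial>\<mu> n) - (\<integral>x. \<phi> x \<partial>\<nu>)\<bar> \<le> (d::real)"
proof -
  obtain \<Omega> :: "real measure" and Z and Y :: "real \<Rightarrow> real" where
    "prob_space \<Omega> \<and> (\<forall>n. Z n \<in> borel_measurable \<Omega>) \<and> (\<forall>n. distr \<Omega> borel (Z n) = \<mu> n) \<and>
      Y \<in> measurable \<Omega> lborel \<and> distr \<Omega> borel Y = \<nu> \<and> (\<forall>x\<in>space \<Omega>. (\<lambda>n. Z n x) \<longlonglongrightarrow> Y x)"
    using Skorohod[OF \<mu> \<nu> conv] by (elim exE) (rule that)
  then have "prob_space \<Omega>"
    and Z: "\<And>n. Z n \<in> borel_measurable \<Omega>" "\<And>n. distr \<Omega> borel (Z n) = \<mu> n"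
    and Y: "Y \<in> borel_measurable \<Omega>" "distr \<Omega> borel Y = \<nu>"
    and lim: "\<And>x. x \<in> space \<Omega> \<Longrightarrow> (\<lambda>n. Z n x) \<longlonglongrightarrow> Y x"
    by auto
  note [measurable] = Z(1) Y(1)
  interpret prob_space \<Omega> by fact
  have int: "integrable \<Omega> (\<lambda>x. min 2 (L * \<bar>Z n x - Y x\<bar>))" for n
    using L by (intro integrable_const_bound[where B=2]) auto
  have "(\<lambda>n. \<integral>x. min 2 (L * \<bar>Z n x - Y x\<bar>) \<partial>\<Omega>) \<longlonglongrightarrow> (\<integral>x. 0 \<partial>\<Omega>)"
  proof (rule integral_dominated_convergence[where w="\<lambda>_. 2"])
    show "AE x in \<Omega>. (\<lambda>n. min 2 (L * \<bar>Z n x - Y x\<bar>)) \<longlonglongrightarrow> 0"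
    proof (rule AE_I2)
      fix x assume "x \<in> space \<Omega>"
      have "(\<lambda>n. min 2 (L * \<bar>Z n x - Y x\<bar>)) \<longlonglongrightarrow> min 2 (L * \<bar>Y x - Y x\<bar>)"
        by (intro tendsto_intros lim) fact
      then show "(\<lambda>n. min 2 (L * \<bar>Z n x - Y x\<bar>)) \<longlonglongrightarrow> 0" by simp
    qed
    show "AE x in \<Omega>. norm (min 2 (L * \<bar>Z n x - Y x\<bar>)) \<le> 2" for n
      using L by (intro AE_I2) (simp add: min_def)
  qed auto
  then have "\<forall>\<^sub>F n in sequentially. (\<integral>x. min 2 (L * \<bar>Z n x - Y x\<bar>) \<partial>\<Omega>) < d"
    using d by (intro order_tendstoD) auto
  then show ?thesis
  proof eventually_elim
    case (elim n)
    show ?case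
    proof (intro allI impI)
      fix \<phi> :: "real \<Rightarrow> real"
      assume le: "\<forall>x. \<bar>\<phi> x\<bar> \<le> 1" and lip: "\<forall>x y. \<bar>\<phi> x - \<phi> y\<bar> \<le> L * \<bar>x - y\<bar>"
        and "continuous_on UNIV \<phi>"
      then have [measurable]: "\<phi> \<in> borel_measurable borel"
        by (intro borel_measurable_continuous_onI)
      have i: "integrable \<Omega> (\<lambda>x. \<phi> (Z n x))" "integrable \<Omega> (\<lambda>x. \<phi> (Y x))"
        using le by (auto intro!: integrable_const_bound[where B=1])
      have "(\<integral>x. \<phi> x \<partial>\<mu> n) - (\<integral>x. \<phi> x \<partial>\<nu>) = (\<integral>x. \<phi> (Z n x) - \<phi> (Y x) \<partial>\<Omega>)"
        using i by (simp add: integral_distr flip: Z(2) Y(2))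
      also have "\<bar>\<dots>\<bar> \<le> (\<integral>x. \<bar>\<phi> (Z n x) - \<phi> (Y x)\<bar> \<partial>\<Omega>)"
        by (rule integral_abs_bound)
      also have "\<dots> \<le> (\<integral>x. min 2 (L * \<bar>Z n x - Y x\<bar>) \<partial>\<Omega>)"
      proof (rule integral_mono)
        show "\<bar>\<phi> (Z n x) - \<phi> (Y x)\<bar> \<le> min 2 (L * \<bar>Z n x - Y x\<bar>)" for x
          using le[rule_format, of "Z n x"] le[rule_format, of "Y x"] lip by auto
      qed (use i int in auto)
      also note less_imp_le[OF elim]
      finally show "\<bar>(\<integral>x. \<phi> x \<partial>\<mu> n) - (\<integral>x. \<phi> x \<partial>\<nu>)\<bar> \<le> d" .
    qed
  qed
qed

text \<open>As \<epsilon> decreases to 0 the integrand decreases to the indicator of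
  \<open>{0}\<close>, which is null, and dominated convergence applies.\<close>

lemma concentration_at_zero:
  fixes \<nu> :: "real measure"
  assumes "real_distribution \<nu>" "measure \<nu> {0} = 0" "d > 0"
  obtains \<epsilon> where "\<epsilon> > 0" "(\<integral>x. \<epsilon> / (x\<^sup>2 + \<epsilon>) \<partial>\<nu>) < (d::real)"
proof -
  interpret real_distribution \<nu> by fact
  define \<epsilon> where "\<epsilon> j = 1 / real (Suc j)" for j
  have \<epsilon>: "\<epsilon> j > 0" for j by (simp add: \<epsilon>_def)
  have \<epsilon>0: "\<epsilon> \<longlonglongrightarrow> 0"
    unfolding \<epsilon>_def by (rule LIMSEQ_Suc[OF lim_1_over_n])
  have "emeasure \<nu> {0} = 0"
    using assms(2) by (simp add: emeasure_eq_measure)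
  then have ae: "AE x in \<nu>. x \<noteq> 0"
    by (intro AE_I[where N="{0}"]) auto
  have "(\<lambda>j. \<integral>x. \<epsilon> j / (x\<^sup>2 + \<epsilon> j) \<partial>\<nu>) \<longlonglongrightarrow> (\<integral>x. 0 \<partial>\<nu>)"
  proof (rule integral_dominated_convergence[where w="\<lambda>_. 1"])
    show "AE x in \<nu>. (\<lambda>j. \<epsilon> j / (x\<^sup>2 + \<epsilon> j)) \<longlonglongrightarrow> 0"
      using ae
    proof eventually_elim
      case (elim x)
      then have "(\<lambda>j. \<epsilon> j / (x\<^sup>2 + \<epsilon> j)) \<longlonglongrightarrow> 0 / (x\<^sup>2 + 0)"
        by (intro tendsto_intros \<epsilon>0) auto
      then show ?case by simp
    qed
    show "AE x in \<nu>. norm (\<epsilon> j / (x\<^sup>2 + \<epsilon> j)) \<le> 1" for j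
      using \<epsilon>[of j] by (intro AE_I2) (simp add: divide_simps add_nonneg_pos)
  qed auto
  then have "\<forall>\<^sub>F j in sequentially. (\<integral>x. \<epsilon> j / (x\<^sup>2 + \<epsilon> j) \<partial>\<nu>) < d"
    using assms(3) by (intro order_tendstoD) auto
  then show thesis
    using that \<epsilon> by (auto simp: eventually_sequentially)
qed

lemma real_distribution_PX:
  assumes [measurable]: "f \<in> borel_measurable borel"
  shows "real_distribution (distr PX borel f)"
  by (intro PX.real_distribution_distr) measurable

text \<open>A deterministic criterion for one fixed sequence of coefficients. The variable
  \<open>g\<close> enters through its law \<kappa> only, which later allows all \<open>g\<close> to
  be treated on one almost sure event.\<close>

theorem dTV_X_harmonic_sum_tendsto_0:
  fixes u v :: "nat \<Rightarrow> real" and \<kappa> \<nu> :: "real measure"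
  assumes conv0: "weak_conv_m (\<lambda>n. distr PX borel (harmonic_sum 0 n u v)) \<kappa>"
    and conv1: "weak_conv_m (\<lambda>n. distr PX borel (harmonic_sum 1 n u v)) \<nu>"
    and \<kappa>: "real_distribution \<kappa>" and \<nu>: "real_distribution \<nu>" "measure \<nu> {0} = 0"
    and K: "\<And>n. (\<Sum>k=1..n. (u k)\<^sup>2 + (v k)\<^sup>2) \<le> K * real n"
    and g: "g \<in> borel_measurable PX" "distr PX borel g = \<kappa>"
  shows "(\<lambda>n. dTV_X PX (harmonic_sum 0 n u v) g) \<longlonglongrightarrow> 0"
proof (rule LIMSEQ_I)
  fix r :: real assume "r > 0"
  \<comment> \<open>The bound reached below is \<open>7 * d\<close>: smoothing costs
    \<open>3 * d\<close> under each of \<open>\<mu> n\<close> and \<kappa>, and the smoothed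
    function costs \<open>d\<close>. The eighth part makes the final inequality strict.\<close>
  define d where "d = r / 8"
  have d: "d > 0" using \<open>r > 0\<close> by (simp add: d_def)
  interpret \<kappa>: real_distribution \<kappa> by fact
  define \<mu> where "\<mu> n = distr PX borel (harmonic_sum 0 n u v)" for n
  have \<mu>: "real_distribution (\<mu> n)" for n
    unfolding \<mu>_def by (rule real_distribution_PX) measurable
  have int_\<mu>: "(\<integral>x. \<phi> x \<partial>\<mu> n) = (\<integral>t. \<phi> (harmonic_sum 0 n u v t) \<partial>PX)"
    if "\<phi> \<in> borel_measurable borel" for n and \<phi> :: "real \<Rightarrow> real"
    unfolding \<mu>_def using that by (intro integral_distr) auto
  have "K \<ge> 0" using order_trans[OF sum_power2_ge_zero, of "u 1" "v 1" K] K[of 1] by simp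

  obtain \<epsilon> where \<epsilon>: "\<epsilon> > 0" "(\<integral>x. \<epsilon> / (x\<^sup>2 + \<epsilon>) \<partial>\<nu>) < d"
    using concentration_at_zero[OF \<nu> d] .
  have nz: "x\<^sup>2 + \<epsilon> \<noteq> 0" for x :: real
    using \<epsilon> by (metis add_nonneg_pos less_irrefl zero_le_power2)
  have "(\<lambda>n. \<integral>x. \<epsilon> / (x\<^sup>2 + \<epsilon>) \<partial>distr PX borel (harmonic_sum 1 n u v))
      \<longlonglongrightarrow> (\<integral>x. \<epsilon> / (x\<^sup>2 + \<epsilon>) \<partial>\<nu>)"
  proof (rule weak_conv_imp_integral_bdd_continuous_conv[OF _ \<nu>(1) conv1, where B=1])
    show "isCont (\<lambda>x. \<epsilon> / (x\<^sup>2 + \<epsilon>)) x" for x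
      using nz by (intro continuous_intros) auto
    show "norm (\<epsilon> / (x\<^sup>2 + \<epsilon>)) \<le> 1" for x
      using \<epsilon> by (simp add: divide_simps add_nonneg_pos)
  qed (rule real_distribution_PX, measurable)
  then have "\<forall>\<^sub>F n in sequentially.
      (\<integral>x. \<epsilon> / (x\<^sup>2 + \<epsilon>) \<partial>distr PX borel (harmonic_sum 1 n u v)) < d"
    using \<epsilon>(2) by (rule order_tendstoD)
  then have ev1: "\<forall>\<^sub>F n in sequentially. (\<integral>t. \<epsilon> / ((harmonic_sum 1 n u v t)\<^sup>2 + \<epsilon>) \<partial>PX) < d"
    by (simp add: integral_distr)

  \<comment> \<open>With the L1 norm of \<open>S\<close> at most \<open>1 + K\<close>, this makes
    the first term of the integration by parts at most \<open>d\<close>. Here \<epsilon> is already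
    fixed.\<close>
  define h where "h = d * \<epsilon> / (1 + K)"
  have h: "h > 0" using d \<epsilon> \<open>K \<ge> 0\<close> by (simp add: h_def)

  have S: "(\<integral>t. \<bar>harmonic_sum 2 n u v t\<bar> \<partial>PX) \<le> 1 + K" if "n > 0" for n
  proof -
    have "(\<integral>t. \<bar>harmonic_sum 2 n u v t\<bar> \<partial>PX) \<le> sqrt (\<integral>t. (harmonic_sum 2 n u v t)\<^sup>2 \<partial>PX)"
      by (intro PX_abs_integral_le_sqrt continuous_intros)
    also have "\<dots> \<le> sqrt (K * real n / (2 * real n))"
      using PX_harmonic_sum_sq_le[of 2 n u v] divide_right_mono[OF K[of n], of "2 * real n"]
      by (intro real_sqrt_le_mono) simp
    also have "\<dots> \<le> sqrt ((1 + K)\<^sup>2)"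
      using that \<open>K \<ge> 0\<close> by (intro real_sqrt_le_mono) (simp add: power2_eq_square algebra_simps)
    also have "\<dots> = 1 + K" using \<open>K \<ge> 0\<close> by simp
    finally show ?thesis .
  qed

  \<comment> \<open>Meant for a test minus its average, hence the bound 2: one \<open>d\<close>
    comes from the choice of \<open>h\<close>, two from the mass of \<open>D\<close> near 0.\<close>
  have smoothing_error: "\<bar>\<integral>x. f x \<partial>\<mu> n\<bar> \<le> 3 * d"
    if n: "n > 0" "(\<integral>t. \<epsilon> / ((harmonic_sum 1 n u v t)\<^sup>2 + \<epsilon>) \<partial>PX) < d"
      and f: "continuous_on UNIV f" "\<And>x. \<bar>f x\<bar> \<le> 2"
      and \<psi>: "\<And>x. (\<psi> has_real_derivative f x) (at x)" "\<And>x. \<bar>\<psi> x\<bar> \<le> h"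
    for n f \<psi>
  proof -
    have [measurable]: "f \<in> borel_measurable borel"
      using f(1) by (rule borel_measurable_continuous_onI)
    have "\<bar>\<integral>x. f x \<partial>\<mu> n\<bar> \<le> h / \<epsilon> * (\<integral>t. \<bar>harmonic_sum 2 n u v t\<bar> \<partial>PX)
        + 2 * (\<integral>t. \<epsilon> / ((harmonic_sum 1 n u v t)\<^sup>2 + \<epsilon>) \<partial>PX)"
      unfolding int_\<mu>[OF \<open>f \<in> borel_measurable borel\<close>]
    proof (rule PX_integration_by_parts[where m="real n" and \<psi>=\<psi> and g=f
          and F="harmonic_sum 0 n u v" and D="harmonic_sum 1 n u v"])
      show "(harmonic_sum 0 n u v has_real_derivative real n * harmonic_sum 1 n u v t) (at t)"
           "(harmonic_sum 1 n u v has_real_derivative real n * harmonic_sum 2 n u v t) (at t)" for t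
        using has_derivative_harmonic_sum[OF n(1), of 0 u v t]
          has_derivative_harmonic_sum[OF n(1), of 1 u v t] by (simp_all add: numeral_2_eq_2)
    qed (use n \<epsilon> f \<psi> in \<open>auto intro: continuous_intros harmonic_sum_2pi\<close>)
    also have "\<dots> \<le> h / \<epsilon> * (1 + K) + 2 * d"
      using S[OF n(1)] n(2) h \<epsilon> by (intro add_mono mult_left_mono) auto
    also have "h / \<epsilon> * (1 + K) = d"
      using \<open>K \<ge> 0\<close> \<epsilon> by (simp add: h_def)
    finally show ?thesis by simp
  qed

  have ev2: "\<forall>\<^sub>F n in sequentially. \<forall>\<phi>. (\<forall>x. \<bar>\<phi> x\<bar> \<le> 1) \<longrightarrow> (\<forall>x y. \<bar>\<phi> x - \<phi> y\<bar> \<le> 2 / h * \<bar>x - y\<bar>)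
    \<longrightarrow> continuous_on UNIV \<phi> \<longrightarrow> \<bar>(\<integral>x. \<phi> x \<partial>\<mu> n) - (\<integral>x. \<phi> x \<partial>\<kappa>)\<bar> \<le> d"
    using h d conv0 \<mu> \<kappa> by (intro uniform_Lipschitz_convergence) (auto simp: \<mu>_def[abs_def])

  have "\<forall>\<^sub>F n in sequentially. dTV_X PX (harmonic_sum 0 n u v) g \<in> {0..7 * d}"
    using ev1 ev2 eventually_gt_at_top[of 0]
  proof eventually_elim
    case (elim n)
    have cont: "(\<integral>x. \<phi> x \<partial>\<mu> n) - (\<integral>x. \<phi> x \<partial>\<kappa>) \<le> 7 * d"
      if \<phi>: "continuous_on UNIV \<phi>" "\<And>x. \<bar>\<phi> x\<bar> \<le> 1" for \<phi>
    proof -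
      obtain \<phi>' \<psi> where \<phi>': "\<And>x. \<bar>\<phi>' x\<bar> \<le> 1" "\<And>x y. \<bar>\<phi>' x - \<phi>' y\<bar> \<le> 2 / h * \<bar>x - y\<bar>"
        "continuous_on UNIV \<phi>'"
        and \<psi>: "\<And>x. (\<psi> has_real_derivative \<phi> x - \<phi>' x) (at x)" "\<And>x. \<bar>\<psi> x\<bar> \<le> h"
        using Lipschitz_smoothing[OF \<phi> h] by metis
      have f: "continuous_on UNIV (\<lambda>x. \<phi> x - \<phi>' x)" "\<And>x. \<bar>\<phi> x - \<phi>' x\<bar> \<le> 2"
      proof -
        show "continuous_on UNIV (\<lambda>x. \<phi> x - \<phi>' x)"
          using \<phi>(1) \<phi>'(3) by (intro continuous_intros)
        show "\<bar>\<phi> x - \<phi>' x\<bar> \<le> 2" for x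
          using \<phi>(2)[of x] \<phi>'(1)[of x] by linarith
      qed
      have split: "(\<integral>x. \<phi> x - \<phi>' x \<partial>\<rho>) = (\<integral>x. \<phi> x \<partial>\<rho>) - (\<integral>x. \<phi>' x \<partial>\<rho>)"
        if "real_distribution \<rho>" for \<rho>
      proof -
        interpret real_distribution \<rho> by fact
        show ?thesis
          using integrable_continuous_bounded[OF \<phi>] integrable_continuous_bounded[OF \<phi>'(3,1)] by simp
      qed
      \<comment> \<open>The limit law inherits the smoothing estimate from the laws
        \<open>\<mu> m\<close> with large \<open>m\<close>, because
        \<open>\<phi> x - \<phi>' x\<close> is bounded and continuous in \<open>x\<close>.\<close>
      have "(\<lambda>m. \<bar>\<integral>x. \<phi> x - \<phi>' x \<partial>\<mu> m\<bar>) \<longlonglongrightarrow> \<bar>\<integral>x. \<phi> x - \<phi>' x \<partial>\<kappa>\<bar>"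
        using f conv0[folded \<mu>_def]
        by (intro tendsto_rabs weak_conv_imp_integral_bdd_continuous_conv[OF \<mu> \<kappa>, where B=2])
          (auto simp: continuous_on_eq_continuous_at)
      then have "\<bar>\<integral>x. \<phi> x - \<phi>' x \<partial>\<kappa>\<bar> \<le> 3 * d"
      proof (rule tendsto_upperbound)
        show "\<forall>\<^sub>F m in sequentially. \<bar>\<integral>x. \<phi> x - \<phi>' x \<partial>\<mu> m\<bar> \<le> 3 * d"
          using ev1 eventually_gt_at_top[of 0]
          by eventually_elim (rule smoothing_error[OF _ _ f \<psi>])
      qed simp
      moreover have "\<bar>\<integral>x. \<phi> x - \<phi>' x \<partial>\<mu> n\<bar> \<le> 3 * d"
        using elim by (intro smoothing_error[OF _ _ f \<psi>])
      moreover have "\<bar>(\<integral>x. \<phi>' x \<partial>\<mu> n) - (\<integral>x. \<phi>' x \<partial>\<kappa>)\<bar> \<le> d"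
        using elim \<phi>' by blast
      ultimately show ?thesis
        unfolding split[OF \<mu>] split[OF \<kappa>] by linarith
    qed
    have test: "(\<integral>t. \<phi> (harmonic_sum 0 n u v t) \<partial>PX) - (\<integral>t. \<phi> (g t) \<partial>PX) \<le> 7 * d"
      if \<phi>: "\<phi> \<in> borel_measurable borel" "\<And>x. \<bar>\<phi> x\<bar> \<le> 1" for \<phi>
    proof -
      have "(\<integral>t. \<phi> (g t) \<partial>PX) = (\<integral>x. \<phi> x \<partial>\<kappa>)"
        unfolding g(2)[symmetric] using \<phi> g(1) by (intro integral_distr[symmetric])
      then show ?thesis
        using borel_test_le_continuous_test[OF \<mu> \<kappa> cont \<phi>] int_\<mu>[OF \<phi>(1)] by simp
    qed
    let ?\<Phi> = "{\<phi> \<in> borel_measurable borel. \<forall>y. \<bar>\<phi> y\<bar> \<le> (1::real)} :: (real \<Rightarrow> real) set"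
    let ?J = "\<lambda>\<phi>. (\<integral>t. \<phi> (harmonic_sum 0 n u v t) \<partial>PX) - (\<integral>t. \<phi> (g t) \<partial>PX)"
    \<comment> \<open>The zero test shows that the set of tests is inhabited and that the supremum
      is nonnegative; boundedness above comes from \<open>test\<close>.\<close>
    have 0: "(\<lambda>_. 0) \<in> ?\<Phi>" by simp
    have "(SUP \<phi>\<in>?\<Phi>. ?J \<phi>) \<le> 7 * d"
    proof (rule cSUP_least)
      show "?\<Phi> \<noteq> {}" using 0 by blast
    qed (use test in auto)
    moreover have "?J (\<lambda>_. 0) \<le> (SUP \<phi>\<in>?\<Phi>. ?J \<phi>)"
      using test by (intro cSUP_upper 0 bdd_aboveI2) auto
    ultimately show ?case
      by (simp add: dTV_X_def)
  qed
  then show "\<exists>no. \<forall>n\<ge>no. norm (dTV_X PX (harmonic_sum 0 n u v) g - 0) < r"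
    using \<open>r > 0\<close> by (force simp: eventually_sequentially d_def)
qed

subsection \<open>From fourth powers to all indices\<close>

lemma cmod_iexp_diff_le: "cmod (iexp x - iexp y) \<le> \<bar>x - y\<bar>"
proof -
  have "iexp x - iexp y = iexp y * (iexp (x - y) - 1)"
    by (simp add: right_diff_distrib flip: exp_add)
  also have "cmod \<dots> = cmod (iexp (x - y) - 1)"
    by (simp add: norm_mult)
  also have "\<dots> \<le> \<bar>x - y\<bar>"
    using iexp_approx1[of "x - y" 0] by simp
  finally show ?thesis .
qed

lemma char_distr_PX:
  assumes [measurable]: "f \<in> borel_measurable borel"
  shows "char (distr PX borel f) \<xi> = (\<integral>t. iexp (\<xi> * f t) \<partial>PX)"
  unfolding char_def by (rule integral_distr) measurable

text \<open>Two functions and two frequencies are allowed because the bound is used in two ways: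
  equal frequencies compare different degrees, equal functions give the Lipschitz estimate in
  \<xi>.\<close>

lemma char_PX_diff_le:
  fixes f g :: "real \<Rightarrow> real"
  assumes f: "continuous_on UNIV f" and g: "continuous_on UNIV g"
  shows "cmod (char (distr PX borel f) \<xi> - char (distr PX borel g) \<zeta>)
    \<le> (\<integral>t. \<bar>\<xi> * f t - \<zeta> * g t\<bar> \<partial>PX)"
proof -
  have [measurable]: "f \<in> borel_measurable borel" "g \<in> borel_measurable borel"
    using f g by (simp_all add: borel_measurable_continuous_onI)
  have i: "integrable PX (\<lambda>t. iexp (\<xi> * f t))" "integrable PX (\<lambda>t. iexp (\<zeta> * g t))"
    by (intro PX.integrable_const_bound[where B=1]; simp)+
  have "char (distr PX borel f) \<xi> - char (distr PX borel g) \<zeta>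
      = (\<integral>t. iexp (\<xi> * f t) - iexp (\<zeta> * g t) \<partial>PX)"
    using i by (simp add: char_distr_PX)
  also have "cmod \<dots> \<le> (\<integral>t. cmod (iexp (\<xi> * f t) - iexp (\<zeta> * g t)) \<partial>PX)"
    by (rule integral_norm_bound)
  also have "\<dots> \<le> (\<integral>t. \<bar>\<xi> * f t - \<zeta> * g t\<bar> \<partial>PX)"
    using i f g
    by (intro integral_mono cmod_iexp_diff_le PX_integrable_continuous continuous_intros) auto
  finally show ?thesis .
qed

abbreviation coeff_energy :: "(nat \<Rightarrow> real) \<Rightarrow> (nat \<Rightarrow> real) \<Rightarrow> nat \<Rightarrow> real" where
  "coeff_energy u v n \<equiv> (\<Sum>k=1..n. (u k)\<^sup>2 + (v k)\<^sup>2)"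

lemma PX_abs_harmonic_sum_le:
  "(\<integral>t. \<bar>harmonic_sum p n u v t\<bar> \<partial>PX) \<le> sqrt (coeff_energy u v n / (2 * real n))"
  using PX_abs_integral_le_sqrt[OF continuous_on_harmonic_sum[of UNIV p n u v]]
    real_sqrt_le_mono[OF PX_harmonic_sum_sq_le[of p n u v]] by linarith

text \<open>Since (k/n)^p = (N/n)^p (k/N)^p, the terms up to \<open>N\<close> of the sum of degree
  \<open>n\<close> are exactly \<open>r\<close> times the sum of degree \<open>N\<close>. What
  remains is a block of high frequencies, whose size is governed by the increment of energy. Both
  errors vanish when N/n tends to 1 and the energy grows linearly.\<close>

lemma char_harmonic_sum_interpolation:
  fixes u v :: "nat \<Rightarrow> real" and p :: nat
  assumes N: "0 < N" "N \<le> n"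
  defines "r \<equiv> (real N / real n) ^ p * sqrt (real N / real n)"
  shows "cmod (char (distr PX borel (harmonic_sum p n u v)) \<xi>
      - char (distr PX borel (harmonic_sum p N u v)) \<xi>)
    \<le> \<bar>\<xi>\<bar> * (sqrt ((coeff_energy u v n - coeff_energy u v N) / (2 * real n))
       + (1 - r) * sqrt (coeff_energy u v N / (2 * real N)))"
proof -
  have r: "0 \<le> r" "r \<le> 1"
    using N unfolding r_def by (auto intro!: mult_le_one power_le_one)
  \<comment> \<open>Zeroing the low coefficients presents the tail as a full harmonic sum of degree
    \<open>n\<close>, to which the L1 bound by the energy applies.\<close>
  define u' v' where "u' k = (if k \<le> N then 0 else u k)" and "v' k = (if k \<le> N then 0 else v k)" for k
  have split_sum: "(\<Sum>k=1..n. f k) = (\<Sum>k=1..N. f k) + (\<Sum>k=N+1..n. f k)" for f :: "nat \<Rightarrow> real"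
    using N sum.ub_add_nat[of 1 N f "n - N"] by simp
  have tail: "(\<Sum>k=1..n. f' k) = (\<Sum>k=N+1..n. f k)"
    if "\<And>k. k \<le> N \<Longrightarrow> f' k = 0" "\<And>k. \<not> k \<le> N \<Longrightarrow> f' k = f k" for f f' :: "nat \<Rightarrow> real"
  proof -
    have "(\<Sum>k=1..N. f' k) = 0" using that(1) by (intro sum.neutral) auto
    moreover have "(\<Sum>k=N+1..n. f' k) = (\<Sum>k=N+1..n. f k)"
      using that(2) by (intro sum.cong) auto
    ultimately show ?thesis using split_sum[of f'] by simp
  qed
  have decomp: "harmonic_sum p n u v t = harmonic_sum p n u' v' t + r * harmonic_sum p N u v t" for t
  proof -
    define h where "h k = u k * cos (real k * t + real p * pi / 2) + v k * sin (real k * t + real p * pi / 2)" for k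
    have sq: "1 / sqrt (real n) = sqrt (real N / real n) * (1 / sqrt (real N))"
      using N by (simp add: real_sqrt_divide)
    have pw: "(real N / real n) ^ p * (real k / real N) ^ p = (real k / real n) ^ p" for k
      using N by (simp flip: power_mult_distrib)
    have "r * harmonic_sum p N u v t
        = (sqrt (real N / real n) * (1 / sqrt (real N))) * (\<Sum>k=1..N. ((real N / real n) ^ p * (real k / real N) ^ p) * h k)"
      unfolding harmonic_sum_def r_def h_def[symmetric] by (simp add: sum_distrib_left mult_ac)
    also have "\<dots> = (1 / sqrt (real n)) * (\<Sum>k=1..N. (real k / real n) ^ p * h k)"
      unfolding pw sq ..
    finally have 1: "r * harmonic_sum p N u v t = (1 / sqrt (real n)) * (\<Sum>k=1..N. (real k / real n) ^ p * h k)" .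
    have 2: "harmonic_sum p n u' v' t = (1 / sqrt (real n)) * (\<Sum>k=N+1..n. (real k / real n) ^ p * h k)"
      unfolding harmonic_sum_def by (subst tail) (auto simp: u'_def v'_def h_def)
    show ?thesis
      unfolding 1 2 by (simp only: harmonic_sum_def h_def[symmetric] split_sum distrib_left add.commute)
  qed
  have energy: "coeff_energy u' v' n = coeff_energy u v n - coeff_energy u v N"
    by (subst tail[where f="\<lambda>k. (u k)\<^sup>2 + (v k)\<^sup>2"]) (use split_sum[of "\<lambda>k. (u k)\<^sup>2 + (v k)\<^sup>2"] in \<open>auto simp: u'_def v'_def\<close>)
  have "cmod (char (distr PX borel (harmonic_sum p n u v)) \<xi>
      - char (distr PX borel (harmonic_sum p N u v)) \<xi>)
      \<le> (\<integral>t. \<bar>\<xi> * harmonic_sum p n u v t - \<xi> * harmonic_sum p N u v t\<bar> \<partial>PX)"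
    by (intro char_PX_diff_le continuous_intros)
  also have "\<dots> \<le> (\<integral>t. \<bar>\<xi>\<bar> * (\<bar>harmonic_sum p n u' v' t\<bar> + (1 - r) * \<bar>harmonic_sum p N u v t\<bar>) \<partial>PX)"
  proof (rule integral_mono)
    show "\<bar>\<xi> * harmonic_sum p n u v t - \<xi> * harmonic_sum p N u v t\<bar>
      \<le> \<bar>\<xi>\<bar> * (\<bar>harmonic_sum p n u' v' t\<bar> + (1 - r) * \<bar>harmonic_sum p N u v t\<bar>)" for t
    proof -
      have "\<xi> * harmonic_sum p n u v t - \<xi> * harmonic_sum p N u v t
        = \<xi> * (harmonic_sum p n u' v' t - (1 - r) * harmonic_sum p N u v t)"
        unfolding decomp by (simp add: algebra_simps)
      also have "\<bar>\<dots>\<bar> \<le> \<bar>\<xi>\<bar> * (\<bar>harmonic_sum p n u' v' t\<bar> + \<bar>(1 - r) * harmonic_sum p N u v t\<bar>)"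
        unfolding abs_mult[of \<xi>] by (intro mult_left_mono abs_triangle_ineq4) auto
      finally show ?thesis using r by (simp add: abs_mult)
    qed
  qed (intro PX_integrable_continuous continuous_intros)+
  also have "\<dots> = \<bar>\<xi>\<bar> * ((\<integral>t. \<bar>harmonic_sum p n u' v' t\<bar> \<partial>PX) + (1 - r) * (\<integral>t. \<bar>harmonic_sum p N u v t\<bar> \<partial>PX))"
  proof -
    have "integrable PX (\<lambda>t. \<bar>harmonic_sum p m x y t\<bar>)" for m x y
      by (intro PX_integrable_continuous continuous_intros)
    then show ?thesis by simp
  qed
  also have "\<dots> \<le> \<bar>\<xi>\<bar> * (sqrt ((coeff_energy u v n - coeff_energy u v N) / (2 * real n))
       + (1 - r) * sqrt (coeff_energy u v N / (2 * real N)))"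
    using r PX_abs_harmonic_sum_le[of p n u' v', unfolded energy] PX_abs_harmonic_sum_le[of p N u v]
    by (intro mult_left_mono add_mono) auto
  finally show ?thesis .
qed

text \<open>The variance bound is summable only along \<open>n = m\<^sup>4\<close>; the other indices \<open>n\<close> are compared with
  \<open>(root4 n) ^ 4\<close>.\<close>
definition root4 :: "nat \<Rightarrow> nat" where
  "root4 n = nat \<lfloor>root 4 (real n)\<rfloor>"

lemma root4_le: "root4 n ^ 4 \<le> n"
proof -
  have "real (root4 n) \<le> root 4 (real n)"
    unfolding root4_def by (simp add: of_nat_floor)
  then have "real (root4 n) ^ 4 \<le> root 4 (real n) ^ 4"
    by (intro power_mono) auto
  also have "\<dots> = real n" by (rule real_root_pow_pos2) auto
  finally show ?thesis by (metis of_nat_le_iff of_nat_power)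
qed

lemma less_Suc_root4: "n < Suc (root4 n) ^ 4"
proof -
  have "root 4 (real n) < real (Suc (root4 n))"
    unfolding root4_def by linarith
  then have "root 4 (real n) ^ 4 < real (Suc (root4 n)) ^ 4"
    by (intro power_strict_mono) auto
  moreover have "root 4 (real n) ^ 4 = real n" by (rule real_root_pow_pos2) auto
  ultimately show ?thesis by (metis of_nat_less_iff of_nat_power)
qed

lemma filterlim_root4: "filterlim root4 at_top sequentially"
  unfolding filterlim_at_top
proof
  fix m
  show "\<forall>\<^sub>F n in sequentially. m \<le> root4 n"
    using eventually_ge_at_top[of "m ^ 4"]
  proof eventually_elim
    case (elim n)
    then have "m ^ 4 < Suc (root4 n) ^ 4" using less_Suc_root4[of n] by linarith
    then show ?case using power_less_imp_less_base[of m 4 "Suc (root4 n)"] by simp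
  qed
qed

lemma root4_pos: "n > 0 \<Longrightarrow> root4 n > 0"
  using less_Suc_root4[of n] by (cases "root4 n = 0") auto

text \<open>Consecutive fourth powers have ratio tending to 1, and \<open>n\<close> lies between two
  of them.\<close>

lemma root4_ratio_tendsto: "(\<lambda>n. real (root4 n ^ 4) / real n) \<longlonglongrightarrow> 1"
proof (rule tendsto_sandwich)
  have "(\<lambda>m. (real m / real (Suc m)) ^ 4) \<longlonglongrightarrow> 1 ^ 4"
    by (intro tendsto_intros LIMSEQ_n_over_Suc_n)
  from filterlim_compose[OF this filterlim_root4]
  show "(\<lambda>n. (real (root4 n) / real (Suc (root4 n))) ^ 4) \<longlonglongrightarrow> 1" by simp
  show "\<forall>\<^sub>F n in sequentially. (real (root4 n) / real (Suc (root4 n))) ^ 4 \<le> real (root4 n ^ 4) / real n"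
    using eventually_gt_at_top[of 0]
  proof eventually_elim
    case (elim n)
    have "real n \<le> real (Suc (root4 n) ^ 4)" using less_Suc_root4[of n] by linarith
    then show ?case
      using elim by (simp only: power_divide of_nat_power) (intro divide_left_mono, auto)
  qed
  show "\<forall>\<^sub>F n in sequentially. real (root4 n ^ 4) / real n \<le> 1"
    using eventually_gt_at_top[of 0]
    by eventually_elim (use root4_le in \<open>simp add: divide_le_eq\<close>; metis of_nat_le_iff of_nat_power root4_le)
qed simp_all

text \<open>Monotonicity traps \<open>S n\<close> between its values at the neighbouring fourth
  powers; replacing \<open>n\<close> by either neighbour in the denominator costs a factor tending
  to 1.\<close>

lemma fourth_powers_tendsto_imp_tendsto:
  fixes S :: "nat \<Rightarrow> real"
  assumes mono: "mono S" and nonneg: "\<And>n. 0 \<le> S n"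
    and lim: "(\<lambda>m. S (m ^ 4) / real (m ^ 4)) \<longlonglongrightarrow> c"
  shows "(\<lambda>n. S n / real n) \<longlonglongrightarrow> c"
proof (rule tendsto_sandwich)
  have lim1: "(\<lambda>n. S (root4 n ^ 4) / real (root4 n ^ 4)) \<longlonglongrightarrow> c"
    by (rule filterlim_compose[OF lim filterlim_root4])
  have Suc_root4: "filterlim (\<lambda>n. Suc (root4 n)) at_top sequentially"
    by (rule filterlim_compose[OF filterlim_Suc filterlim_root4])
  have lim2: "(\<lambda>n. S (Suc (root4 n) ^ 4) / real (Suc (root4 n) ^ 4)) \<longlonglongrightarrow> c"
    by (rule filterlim_compose[OF lim Suc_root4])
  have "(\<lambda>n. real (root4 n ^ 4) / real n * (S (root4 n ^ 4) / real (root4 n ^ 4))) \<longlonglongrightarrow> 1 * c"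
    by (intro tendsto_intros root4_ratio_tendsto lim1)
  then show "(\<lambda>n. real (root4 n ^ 4) / real n * (S (root4 n ^ 4) / real (root4 n ^ 4))) \<longlonglongrightarrow> c" by simp
  have "(\<lambda>m. (real (Suc m) / real m) ^ 4) \<longlonglongrightarrow> 1 ^ 4"
    by (intro tendsto_intros LIMSEQ_Suc_n_over_n)
  from filterlim_compose[OF this filterlim_root4]
  have "(\<lambda>n. (real (Suc (root4 n)) / real (root4 n)) ^ 4 * (S (Suc (root4 n) ^ 4) / real (Suc (root4 n) ^ 4))) \<longlonglongrightarrow> 1 ^ 4 * c"
    by (intro tendsto_mult lim2)
  then show "(\<lambda>n. (real (Suc (root4 n)) / real (root4 n)) ^ 4 * (S (Suc (root4 n) ^ 4) / real (Suc (root4 n) ^ 4))) \<longlonglongrightarrow> c"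
    by simp
  show "\<forall>\<^sub>F n in sequentially. real (root4 n ^ 4) / real n * (S (root4 n ^ 4) / real (root4 n ^ 4)) \<le> S n / real n"
    using eventually_gt_at_top[of 0]
  proof eventually_elim
    case (elim n)
    have "S (root4 n ^ 4) \<le> S n" using mono root4_le by (rule monoD)
    then show ?case using elim root4_pos[OF elim] by (simp add: divide_right_mono)
  qed
  show "\<forall>\<^sub>F n in sequentially. S n / real n
      \<le> (real (Suc (root4 n)) / real (root4 n)) ^ 4 * (S (Suc (root4 n) ^ 4) / real (Suc (root4 n) ^ 4))"
    using eventually_gt_at_top[of 0]
  proof eventually_elim
    case (elim n)
    have "S n \<le> S (Suc (root4 n) ^ 4)" using mono less_imp_le[OF less_Suc_root4] by (rule monoD)
    moreover have "real (root4 n ^ 4) \<le> real n" using root4_le[of n] by (simp only: of_nat_le_iff)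
    ultimately have "S n / real n \<le> S (Suc (root4 n) ^ 4) / real (root4 n ^ 4)"
      using root4_pos[OF elim] nonneg by (intro frac_le) auto
    also have "\<dots> = (real (Suc (root4 n)) / real (root4 n)) ^ 4 * (S (Suc (root4 n) ^ 4) / real (Suc (root4 n) ^ 4))"
      using root4_pos[OF elim] by (simp add: power_divide del: of_nat_Suc)
    finally show ?case .
  qed
qed

section \<open>Centred Gaussian laws and the passage from characteristic functions to convergence in
  law\<close>

abbreviation normal_law :: "real \<Rightarrow> real measure" where
  "normal_law \<sigma> \<equiv> distr std_normal_distribution borel (\<lambda>x. \<sigma> * x)"

lemma real_distribution_normal_law: "real_distribution (normal_law \<sigma>)"
proof -
  interpret real_distribution std_normal_distribution by (rule real_dist_normal_dist)
  show ?thesis by (rule real_distribution_distr) simp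
qed

lemma char_normal_law: "char (normal_law \<sigma>) \<xi> = exp (- ((\<sigma> * \<xi>)\<^sup>2) / 2)"
proof -
  have "char (normal_law \<sigma>) \<xi> = char std_normal_distribution (\<sigma> * \<xi>)"
    unfolding char_def by (subst integral_distr) (auto simp: mult_ac)
  then show ?thesis by (simp add: char_std_normal_distribution)
qed

lemma normal_law_one: "normal_law 1 = std_normal_distribution"
  by (simp add: distr_id2)

lemma measure_normal_law_0:
  assumes "\<sigma> \<noteq> 0"
  shows "measure (normal_law \<sigma>) {0} = 0"
proof -
  have "measure (normal_law \<sigma>) {0} = measure std_normal_distribution ((\<lambda>x. \<sigma> * x) -` {0} \<inter> UNIV)"
    by (subst measure_distr) auto
  also have "(\<lambda>x. \<sigma> * x) -` {0} \<inter> UNIV = {0}" using assms by auto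
  also have "measure std_normal_distribution {0} = 0"
  proof -
    have "AE x in lborel. x \<in> {0} \<longrightarrow> ennreal (std_normal_density x) = 0"
      using AE_lborel_singleton[of "0::real"] by eventually_elim auto
    then have "{0} \<in> null_sets std_normal_distribution"
      by (subst null_sets_density_iff) auto
    then show ?thesis by (simp add: measure_def null_setsD1)
  qed
  finally show ?thesis .
qed

text \<open>The hypotheses are what holds almost surely: convergence of characteristic functions for
  countably many frequencies along fourth powers, and linear growth of the energy. The latter is
  used twice, to fill the gaps between fourth powers and to make the characteristic functions
  equicontinuous, so that Levy's theorem applies.\<close>

theorem weak_conv_harmonic_sum:
  fixes u v :: "nat \<Rightarrow> real"
  assumes energy: "(\<lambda>n. coeff_energy u v n / real n) \<longlonglongrightarrow> c"
    and char_lim: "\<And>q. q \<in> \<rat> \<Longrightarrow>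
      (\<lambda>m. char (distr PX borel (harmonic_sum p (m ^ 4) u v)) q) \<longlonglongrightarrow> exp (- ((\<sigma> * q)\<^sup>2) / 2)"
  shows "weak_conv_m (\<lambda>n. distr PX borel (harmonic_sum p n u v)) (normal_law \<sigma>)"
proof (rule levy_continuity)
  define Z where "Z n \<xi> = char (distr PX borel (harmonic_sum p n u v)) \<xi>" for n \<xi>
  define r where "r n = (real (root4 n ^ 4) / real n) ^ p * sqrt (real (root4 n ^ 4) / real n)" for n
  have r1: "r \<longlonglongrightarrow> 1"
  proof -
    have "r \<longlonglongrightarrow> 1 ^ p * sqrt 1"
      unfolding r_def by (intro tendsto_intros root4_ratio_tendsto)
    then show ?thesis by simp
  qed
  have energy4: "(\<lambda>n. coeff_energy u v (root4 n ^ 4) / real (root4 n ^ 4)) \<longlonglongrightarrow> c"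
  proof (rule filterlim_compose[OF energy])
    show "filterlim (\<lambda>n. root4 n ^ 4) at_top sequentially"
      using eventually_gt_at_top[of 0]
      by (intro filterlim_at_top_mono[OF filterlim_root4], eventually_elim)
        (auto intro!: self_le_power root4_pos simp: Suc_le_eq)
  qed
  have rational: "(\<lambda>n. Z n q) \<longlonglongrightarrow> exp (- ((\<sigma> * q)\<^sup>2) / 2)" if "q \<in> \<rat>" for q
  proof -
    have Z4: "(\<lambda>n. Z (root4 n ^ 4) q) \<longlonglongrightarrow> exp (- ((\<sigma> * q)\<^sup>2) / 2)"
      using filterlim_compose[OF char_lim[OF that] filterlim_root4] by (simp add: Z_def)
    have "(\<lambda>n. Z n q - Z (root4 n ^ 4) q) \<longlonglongrightarrow> 0"
    proof (rule Lim_null_comparison)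
      show "\<forall>\<^sub>F n in sequentially. norm (Z n q - Z (root4 n ^ 4) q)
         \<le> \<bar>q\<bar> * (sqrt ((coeff_energy u v n / real n - (real (root4 n ^ 4) / real n)
              * (coeff_energy u v (root4 n ^ 4) / real (root4 n ^ 4))) / 2)
           + (1 - r n) * sqrt (coeff_energy u v (root4 n ^ 4) / real (root4 n ^ 4) / 2))"
        using eventually_gt_at_top[of 0]
      proof eventually_elim
        case (elim n)
        have "coeff_energy u v n / real n - (real (root4 n ^ 4) / real n)
              * (coeff_energy u v (root4 n ^ 4) / real (root4 n ^ 4))
            = (coeff_energy u v n - coeff_energy u v (root4 n ^ 4)) / real n"
          using root4_pos[OF elim] by (simp add: diff_divide_distrib)
        then show ?case
          using char_harmonic_sum_interpolation[of "root4 n ^ 4" n p u v q] root4_pos[OF elim] root4_le[of n]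
          by (simp add: Z_def r_def mult.commute[of 2])
      qed
      \<comment> \<open>Both terms have limit 0: the energies of degrees \<open>n\<close> and
        \<open>root4 n ^ 4\<close>, each divided by \<open>n\<close>, share the limit
        \<open>c\<close>, and \<open>r\<close> tends to 1.\<close>
      have "(\<lambda>n. \<bar>q\<bar> * (sqrt ((coeff_energy u v n / real n - (real (root4 n ^ 4) / real n)
              * (coeff_energy u v (root4 n ^ 4) / real (root4 n ^ 4))) / 2)
           + (1 - r n) * sqrt (coeff_energy u v (root4 n ^ 4) / real (root4 n ^ 4) / 2)))
         \<longlonglongrightarrow> \<bar>q\<bar> * (sqrt ((c - 1 * c) / 2) + (1 - 1) * sqrt (c / 2))"
        by (intro tendsto_intros energy root4_ratio_tendsto energy4 r1) simp_all
      then show "(\<lambda>n. \<bar>q\<bar> * (sqrt ((coeff_energy u v n / real n - (real (root4 n ^ 4) / real n)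
              * (coeff_energy u v (root4 n ^ 4) / real (root4 n ^ 4))) / 2)
           + (1 - r n) * sqrt (coeff_energy u v (root4 n ^ 4) / real (root4 n ^ 4) / 2))) \<longlonglongrightarrow> 0"
        by simp
    qed
    from tendsto_add[OF this Z4] show ?thesis by simp
  qed
  have "Bseq (\<lambda>n. coeff_energy u v n / real n)"
    using energy by (intro convergent_imp_Bseq) (auto simp: convergent_def)
  then obtain K where K: "K > 0" "\<And>n. norm (coeff_energy u v n / real n) \<le> K"
    by (auto simp: Bseq_def)
  \<comment> \<open>The constant does not depend on \<open>n\<close>, which is what carries
    convergence from rational frequencies to all real ones.\<close>
  have Z_Lipschitz: "cmod (Z n \<xi> - Z n \<zeta>) \<le> \<bar>\<xi> - \<zeta>\<bar> * sqrt K" for n \<xi> \<zeta>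
  proof -
    have "cmod (Z n \<xi> - Z n \<zeta>) \<le> (\<integral>t. \<bar>\<xi> * harmonic_sum p n u v t - \<zeta> * harmonic_sum p n u v t\<bar> \<partial>PX)"
      unfolding Z_def by (intro char_PX_diff_le continuous_intros)
    also have "\<dots> = \<bar>\<xi> - \<zeta>\<bar> * (\<integral>t. \<bar>harmonic_sum p n u v t\<bar> \<partial>PX)"
      by (simp add: abs_mult flip: left_diff_distrib)
    also have "\<dots> \<le> \<bar>\<xi> - \<zeta>\<bar> * sqrt (coeff_energy u v n / (2 * real n))"
      by (intro mult_left_mono PX_abs_harmonic_sum_le) simp
    also have "coeff_energy u v n / (2 * real n) = (coeff_energy u v n / real n) / 2" by simp
    also have "\<bar>\<xi> - \<zeta>\<bar> * sqrt \<dots> \<le> \<bar>\<xi> - \<zeta>\<bar> * sqrt K"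
    proof -
      have "coeff_energy u v n / real n \<le> K" using K(2)[of n] unfolding real_norm_def by linarith
      moreover have "x / 2 \<le> K" if "x \<le> K" for x using that K(1) by linarith
      ultimately have "coeff_energy u v n / real n / 2 \<le> K" by blast
      then show ?thesis by (intro mult_left_mono) simp_all
    qed
    finally show ?thesis .
  qed
  show "(\<lambda>n. char (distr PX borel (harmonic_sum p n u v)) \<xi>) \<longlonglongrightarrow> char (normal_law \<sigma>) \<xi>" for \<xi>
    unfolding char_normal_law Z_def[symmetric]
  proof (rule LIMSEQ_I)
    fix e :: real assume "e > 0"
    define G where "G x = complex_of_real (exp (- ((\<sigma> * x)\<^sup>2) / 2))" for x
    have "isCont G \<xi>" unfolding G_def by (intro continuous_intros) auto
    then obtain d where d: "d > 0" "\<And>x. dist x \<xi> < d \<Longrightarrow> dist (G x) (G \<xi>) < e / 3"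
      using \<open>e > 0\<close> unfolding continuous_at_eps_delta by (metis zero_less_divide_iff zero_less_numeral)
    \<comment> \<open>Close enough for both errors of the passage from \<xi> to \<open>q\<close>:
      the oscillation of the Gaussian limit and the Lipschitz bound for \<open>Z n\<close>,
      \<open>e / 3\<close> each.\<close>
    define d' where "d' = min d (e / (3 * sqrt K))"
    have "d' > 0" using d(1) \<open>e > 0\<close> K(1) by (simp add: d'_def)
    then obtain q where q: "q \<in> \<rat>" "\<xi> < q" "q < \<xi> + d'"
      using Rats_dense_in_real[of \<xi> "\<xi> + d'"] by auto
    have "dist q \<xi> < d" using q by (auto simp: dist_real_def d'_def)
    then have Gq: "norm (G q - G \<xi>) < e / 3" using d(2) by (simp add: dist_norm)
    have "\<bar>\<xi> - q\<bar> * sqrt K \<le> d' * sqrt K"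
      using q K(1) by (intro mult_right_mono) auto
    also have "\<dots> \<le> e / (3 * sqrt K) * sqrt K"
      using K(1) by (intro mult_right_mono) (auto simp: d'_def)
    also have "\<dots> = e / 3" using K(1) by simp
    finally have Zq: "norm (Z n \<xi> - Z n q) \<le> e / 3" for n
      using Z_Lipschitz[of n \<xi> q] by linarith
    obtain n0 where n0: "\<And>n. n \<ge> n0 \<Longrightarrow> norm (Z n q - G q) < e / 3"
      using LIMSEQ_D[OF rational[OF q(1)], of "e / 3"] \<open>e > 0\<close> by (auto simp: G_def)
    have "norm (Z n \<xi> - G \<xi>) < e" if "n \<ge> n0" for n
    proof -
      have "norm (Z n \<xi> - G \<xi>) = norm ((Z n \<xi> - Z n q) + (Z n q - G q) + (G q - G \<xi>))" by simp
      also have "\<dots> \<le> norm (Z n \<xi> - Z n q) + norm (Z n q - G q) + norm (G q - G \<xi>)"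
        by (intro norm_triangle_le add_right_mono norm_triangle_ineq)
      also have "\<dots> < e" using Zq[of n] n0[OF that] Gq by linarith
      finally show ?thesis .
    qed
    then show "\<exists>no. \<forall>n\<ge>no. norm (Z n \<xi> - exp (- ((\<sigma> * \<xi>)\<^sup>2) / 2)) < e"
      unfolding G_def by blast
  qed
qed (rule real_distribution_PX real_distribution_normal_law; measurable)+

subsection \<open>Law of large numbers for the squared coefficients\<close>

text \<open>Monotone convergence makes the sum of all \<open>X n\<close> integrable, hence finite
  almost everywhere, so its terms tend to 0. This does the work of Markov and
  Borel-Cantelli.\<close>

lemma AE_tendsto_0_if_summable_integral:
  fixes X :: "nat \<Rightarrow> 'a \<Rightarrow> real"
  assumes int: "\<And>n. integrable M (X n)" and nonneg: "\<And>n w. 0 \<le> X n w"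
    and sum: "summable (\<lambda>n. \<integral>w. X n w \<partial>M)"
  shows "AE w in M. (\<lambda>n. X n w) \<longlonglongrightarrow> 0"
proof -
  have [measurable]: "X n \<in> borel_measurable M" for n using int by auto
  have "(\<integral>\<^sup>+w. (\<Sum>n. ennreal (X n w)) \<partial>M) = (\<Sum>n. \<integral>\<^sup>+w. ennreal (X n w) \<partial>M)"
    by (rule nn_integral_suminf) simp
  also have "\<dots> = (\<Sum>n. ennreal (\<integral>w. X n w \<partial>M))"
    using int nonneg by (simp add: nn_integral_eq_integral)
  also have "\<dots> \<noteq> \<infinity>"
    using sum nonneg by (simp add: ennreal_suminf_neq_top integral_nonneg_AE)
  finally have "AE w in M. (\<Sum>n. ennreal (X n w)) \<noteq> \<infinity>"
    by (intro nn_integral_PInf_AE) auto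
  then show ?thesis
  proof eventually_elim
    case (elim w)
    then have "summable (\<lambda>n. X n w)"
      using nonneg by (intro summable_suminf_not_top) auto
    then show ?case by (rule summable_LIMSEQ_zero)
  qed
qed

lemma exp_minus_le_quadratic:
  fixes z :: real
  assumes "z \<ge> 0"
  shows "exp (- z) \<le> 1 - z + z\<^sup>2 / 2"
proof -
  have "(1 - 0 + 0\<^sup>2 / 2 - exp (- 0)) \<le> (1 - z + z\<^sup>2 / 2 - exp (- z))"
  proof (rule DERIV_nonneg_imp_nondecreasing[OF assms])
    fix x :: real
    have "((\<lambda>z. 1 - z + z\<^sup>2 / 2 - exp (- z)) has_real_derivative - 1 + x + exp (- x)) (at x)"
      by (auto intro!: derivative_eq_intros)
    moreover have "0 \<le> - 1 + x + exp (- x)"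
      using exp_ge_add_one_self[of "- x"] by simp
    ultimately show "\<exists>y. ((\<lambda>z. 1 - z + z\<^sup>2 / 2 - exp (- z)) has_real_derivative y) (at x) \<and> 0 \<le> y"
      by blast
  qed
  then show ?thesis by simp
qed

text \<open>The error is of order y^4 near 0 and at most y^2 far away. The exponent 3 in between is
  valid everywhere and is the one whose expectation the third moment controls.\<close>

lemma abs_exp_minus_sq_le:
  fixes y :: real
  shows "\<bar>exp (- (y\<^sup>2)) - (1 - y\<^sup>2)\<bar> \<le> \<bar>y\<bar> ^ 3"
proof -
  have lower: "0 \<le> exp (- (y\<^sup>2)) - (1 - y\<^sup>2)"
    using exp_ge_add_one_self[of "- (y\<^sup>2)"] by simp
  have "exp (- (y\<^sup>2)) - (1 - y\<^sup>2) \<le> \<bar>y\<bar> ^ 3"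
  proof (cases "\<bar>y\<bar> \<le> 1")
    case True
    have "exp (- (y\<^sup>2)) - (1 - y\<^sup>2) \<le> (y\<^sup>2)\<^sup>2 / 2"
      using exp_minus_le_quadratic[of "y\<^sup>2"] by simp
    also have "\<dots> \<le> \<bar>y\<bar> ^ 4"
      by (simp flip: power_mult)
    also have "\<dots> \<le> \<bar>y\<bar> ^ 3"
      using True by (intro power_decreasing) auto
    finally show ?thesis .
  next
    case False
    have "exp (- (y\<^sup>2)) - (1 - y\<^sup>2) \<le> y\<^sup>2" by simp
    also have "y\<^sup>2 = \<bar>y\<bar>\<^sup>2" by simp
    also have "\<dots> \<le> \<bar>y\<bar> ^ 3"
      using False by (intro power_increasing) auto
    finally show ?thesis .
  qed
  with lower show ?thesis by simp
qed

lemma mono_coeff_energy: "mono (coeff_energy u v)"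
proof (rule monoI)
  show "coeff_energy u v m \<le> coeff_energy u v n" if "m \<le> n" for m n
    using that by (intro sum_mono2) auto
qed

text \<open>The sum type merges both sequences into a single family of \<open>2 * n\<close>
  independent variables with one law.\<close>

definition indices :: "nat \<Rightarrow> (nat + nat) set" where
  "indices n = {1..n} <+> {1..n}"

lemma finite_indices [simp]: "finite (indices n)"
  by (simp add: indices_def)

lemma card_indices: "card (indices n) = 2 * n"
  by (simp add: indices_def card_Plus)

lemma sum_indices: "(\<Sum>i\<in>indices n. f i) = (\<Sum>k=1..n. f (Inl k) + f (Inr k))"
  by (simp add: indices_def sum.Plus sum.distrib o_def)

section \<open>Independent coefficients: characteristic functions of linear forms and the
  energy\<close>

locale iid_coefficients = prob_space M for M :: "'a measure" +
  fixes a b :: "nat \<Rightarrow> 'a \<Rightarrow> real"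
  assumes rv: "\<And>k. k \<ge> 1 \<Longrightarrow> a k \<in> borel_measurable M \<and> b k \<in> borel_measurable M"
    and indep: "indep_vars (\<lambda>_. borel)
                  (\<lambda>i. case i of Inl k \<Rightarrow> a k | Inr k \<Rightarrow> b k) (Inl ` {1..} \<union> Inr ` {1..})"
    and ident: "\<And>k. k \<ge> 1 \<Longrightarrow> distr M borel (a k) = distr M borel (a 1)
                                 \<and> distr M borel (b k) = distr M borel (a 1)"
    and third: "integrable M (\<lambda>w. \<bar>a 1 w\<bar> ^ 3)"
    and mean: "(\<integral>w. a 1 w \<partial>M) = 0"
    and var: "(\<integral>w. (a 1 w)\<^sup>2 \<partial>M) = 1"
begin

definition X :: "nat + nat \<Rightarrow> 'a \<Rightarrow> real" where
  "X i = (case i of Inl k \<Rightarrow> a k | Inr k \<Rightarrow> b k)"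

definition \<eta> :: "'a \<Rightarrow> real" where "\<eta> = a 1"

definition \<rho> :: real where "\<rho> = (\<integral>w. \<bar>\<eta> w\<bar> ^ 3 \<partial>M)"

lemmas third' = third[folded \<eta>_def] and mean' = mean[folded \<eta>_def] and var' = var[folded \<eta>_def]

lemma \<rho>_nonneg: "0 \<le> \<rho>"
  unfolding \<rho>_def by (rule integral_nonneg_AE) simp

lemma \<eta>_measurable [measurable]: "\<eta> \<in> borel_measurable M"
  using rv[of 1] unfolding \<eta>_def by blast

lemma X_measurable: "i \<in> indices n \<Longrightarrow> X i \<in> borel_measurable M"
  using rv by (auto simp: X_def indices_def)

lemma X_distr:
  assumes "i \<in> indices n"
  shows "distr M borel (X i) = distr M borel \<eta>"
proof (cases i)
  case (Inl k)
  then have "1 \<le> k" using assms by (auto simp: indices_def)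
  from ident[OF this] Inl show ?thesis by (simp only: X_def \<eta>_def sum.case)
next
  case (Inr k)
  then have "1 \<le> k" using assms by (auto simp: indices_def)
  from ident[OF this] Inr show ?thesis by (simp only: X_def \<eta>_def sum.case)
qed

lemma X_indep: "indep_vars (\<lambda>_. borel) X (indices n)"
  by (rule indep_vars_subset[OF indep[folded X_def]]) (auto simp: Plus_def indices_def)

lemma X_integral:
  fixes f :: "real \<Rightarrow> 'b::{banach, second_countable_topology}"
  assumes "i \<in> indices n" and [measurable]: "f \<in> borel_measurable borel"
  shows "(\<integral>w. f (X i w) \<partial>M) = (\<integral>w. f (\<eta> w) \<partial>M)"
proof -
  have "(\<integral>w. f (X i w) \<partial>M) = (\<integral>x. f x \<partial>distr M borel (X i))"
    using X_measurable[OF assms(1)] by (intro integral_distr[symmetric]) auto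
  also have "\<dots> = (\<integral>w. f (\<eta> w) \<partial>M)"
    unfolding X_distr[OF assms(1)] by (intro integral_distr) auto
  finally show ?thesis .
qed

lemma \<eta>_integrable: "integrable M \<eta>" "integrable M (\<lambda>w. (\<eta> w)\<^sup>2)"
proof -
  have "\<bar>x\<bar> \<le> 1 + \<bar>x\<bar> ^ 3 \<and> x\<^sup>2 \<le> 1 + \<bar>x\<bar> ^ 3" for x :: real
  proof (cases "\<bar>x\<bar> \<le> 1")
    case True
    have "\<bar>x\<bar> \<le> 1 + \<bar>x\<bar> ^ 3" using True zero_le_power_abs[of x 3] by linarith
    moreover have "x\<^sup>2 \<le> 1 + \<bar>x\<bar> ^ 3"
      using abs_square_le_1[of x] True zero_le_power_abs[of x 3] by linarith
    ultimately show ?thesis ..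
  next
    case False
    then have "\<bar>x\<bar> ^ 1 \<le> \<bar>x\<bar> ^ 3" "\<bar>x\<bar> ^ 2 \<le> \<bar>x\<bar> ^ 3" by (intro power_increasing; simp)+
    then show ?thesis by simp
  qed
  note le = this
  have int: "integrable M (\<lambda>w. 1 + \<bar>\<eta> w\<bar> ^ 3)"
    using third' by simp
  show "integrable M \<eta>"
    by (rule Bochner_Integration.integrable_bound[OF int]) (use le in auto)
  show "integrable M (\<lambda>w. (\<eta> w)\<^sup>2)"
    by (rule Bochner_Integration.integrable_bound[OF int]) (use le in auto)
qed

abbreviation \<mu> :: "real measure" where
  "\<mu> \<equiv> distr M borel \<eta>"

lemma \<mu>_real_distribution: "real_distribution \<mu>"
  by (rule real_distribution_distr) simp

text \<open>Both functions are compared with the common Taylor polynomial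
  \<open>1 - s\<^sup>2 / 2\<close>: \<rho> pays for the law of the coefficients, the added 1 for the
  Gaussian.\<close>

lemma char_\<mu>_approx: "cmod (char \<mu> s - exp (- (s\<^sup>2) / 2)) \<le> (\<rho> + 1) * \<bar>s\<bar> ^ 3"
proof -
  have "cmod (char \<mu> s - (1 - s\<^sup>2 * 1 / 2)) \<le> s\<^sup>2 / 6 * expectation (\<lambda>w. min (6 * (\<eta> w)\<^sup>2) (\<bar>s\<bar> * \<bar>\<eta> w\<bar> ^ 3))"
    using \<eta>_integrable mean' var' by (intro char_approx3') auto
  also have "\<dots> \<le> s\<^sup>2 / 6 * (\<bar>s\<bar> * \<rho>)"
  proof (rule mult_left_mono)
    have "expectation (\<lambda>w. min (6 * (\<eta> w)\<^sup>2) (\<bar>s\<bar> * \<bar>\<eta> w\<bar> ^ 3)) \<le> expectation (\<lambda>w. \<bar>s\<bar> * \<bar>\<eta> w\<bar> ^ 3)"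
      using third' \<eta>_integrable
      by (intro integral_mono) (auto intro!: Bochner_Integration.integrable_bound[OF integrable_mult_right[OF third']])
    then show "expectation (\<lambda>w. min (6 * (\<eta> w)\<^sup>2) (\<bar>s\<bar> * \<bar>\<eta> w\<bar> ^ 3)) \<le> \<bar>s\<bar> * \<rho>"
      by (simp add: \<rho>_def)
  qed simp
  also have "\<dots> = \<rho> * \<bar>s\<bar> ^ 3 / 6"
    by (simp add: power2_eq_square power3_eq_cube)
  also have "\<dots> \<le> \<rho> * \<bar>s\<bar> ^ 3"
    using \<rho>_nonneg by simp
  finally have 1: "cmod (char \<mu> s - (1 - s\<^sup>2 / 2)) \<le> \<rho> * \<bar>s\<bar> ^ 3" by simp
  have "cmod (complex_of_real (1 - s\<^sup>2 / 2) - exp (- (s\<^sup>2) / 2)) = \<bar>exp (- (s\<^sup>2) / 2) - (1 - s\<^sup>2 / 2)\<bar>"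
    by (metis abs_minus_commute norm_of_real of_real_diff exp_of_real)
  also have "\<dots> = \<bar>exp (- ((s / sqrt 2)\<^sup>2)) - (1 - (s / sqrt 2)\<^sup>2)\<bar>"
    by (simp add: power_divide)
  also have "\<dots> \<le> \<bar>s / sqrt 2\<bar> ^ 3"
    by (rule abs_exp_minus_sq_le)
  also have "\<dots> \<le> \<bar>s\<bar> ^ 3"
    using mult_left_mono[of 1 "sqrt 2" "\<bar>s\<bar>"] by (intro power_mono) (simp_all add: divide_le_eq)
  finally have "cmod (complex_of_real (1 - s\<^sup>2 / 2) - exp (- (s\<^sup>2) / 2)) \<le> \<bar>s\<bar> ^ 3" .
  then show ?thesis
    using 1 norm_triangle_ineq[of "char \<mu> s - (1 - s\<^sup>2 / 2)" "complex_of_real (1 - s\<^sup>2 / 2) - exp (- (s\<^sup>2) / 2)"]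
    by (simp add: algebra_simps)
qed

lemma char_linear_combination:
  "(\<integral>w. iexp (\<Sum>i\<in>indices n. s i * X i w) \<partial>M) = (\<Prod>i\<in>indices n. char \<mu> (s i))"
proof -
  have meas: "(\<lambda>w. s i * X i w) \<in> borel_measurable M" if "i \<in> indices n" for i
    using X_measurable[OF that] by simp
  have "(\<integral>w. iexp (\<Sum>i\<in>indices n. s i * X i w) \<partial>M)
      = char (distr M borel (\<lambda>w. \<Sum>i\<in>indices n. s i * X i w)) 1"
    unfolding char_def by (subst integral_distr) (auto intro!: borel_measurable_sum meas)
  also have "\<dots> = (\<Prod>i\<in>indices n. char (distr M borel (\<lambda>w. s i * X i w)) 1)"
    by (intro char_distr_sum indep_vars_compose2[OF X_indep]) auto
  also have "\<dots> = (\<Prod>i\<in>indices n. char \<mu> (s i))"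
  proof (rule prod.cong[OF refl])
    fix i assume i: "i \<in> indices n"
    have "char (distr M borel (\<lambda>w. s i * X i w)) 1 = (\<integral>w. iexp (s i * X i w) \<partial>M)"
      unfolding char_def using meas[OF i] by (subst integral_distr) auto
    also have "\<dots> = (\<integral>w. iexp (s i * \<eta> w) \<partial>M)"
      using X_integral[OF i, of "\<lambda>x. iexp (s i * x)"] by simp
    also have "\<dots> = char \<mu> (s i)"
      unfolding char_def by (subst integral_distr) auto
    finally show "char (distr M borel (\<lambda>w. s i * X i w)) 1 = char \<mu> (s i)" .
  qed
  finally show ?thesis .
qed

text \<open>Lindeberg replacement: all factors have modulus at most 1, so the products differ by at
  most the sum of the differences of their factors. For \<open>2 * n\<close> weights of order
  1/sqrt(n) the sum of cubes is of order 1/sqrt(n).\<close>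

lemma iexp_linear_combination_approx:
  "cmod ((\<integral>w. iexp (\<Sum>i\<in>indices n. s i * X i w) \<partial>M) - exp (- (\<Sum>i\<in>indices n. (s i)\<^sup>2) / 2))
    \<le> (\<rho> + 1) * (\<Sum>i\<in>indices n. \<bar>s i\<bar> ^ 3)"
proof -
  have "exp (- (\<Sum>i\<in>indices n. (s i)\<^sup>2) / 2) = (\<Prod>i\<in>indices n. exp (- ((s i)\<^sup>2) / 2))"
    by (simp add: sum_negf sum_divide_distrib flip: exp_sum)
  then have "cmod ((\<integral>w. iexp (\<Sum>i\<in>indices n. s i * X i w) \<partial>M) - exp (- (\<Sum>i\<in>indices n. (s i)\<^sup>2) / 2))
    = cmod ((\<Prod>i\<in>indices n. char \<mu> (s i)) - (\<Prod>i\<in>indices n. complex_of_real (exp (- ((s i)\<^sup>2) / 2))))"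
    by (simp only: char_linear_combination of_real_prod)
  also have "\<dots> \<le> (\<Sum>i\<in>indices n. cmod (char \<mu> (s i) - complex_of_real (exp (- ((s i)\<^sup>2) / 2))))"
    by (intro norm_prod_diff real_distribution.cmod_char_le_1[OF \<mu>_real_distribution]) simp
  also have "\<dots> \<le> (\<Sum>i\<in>indices n. (\<rho> + 1) * \<bar>s i\<bar> ^ 3)"
    using char_\<mu>_approx by (intro sum_mono) simp
  finally show ?thesis by (simp add: sum_distrib_left)
qed

definition energy :: "'a \<Rightarrow> nat \<Rightarrow> real" where
  "energy w n = coeff_energy (\<lambda>k. a k w) (\<lambda>k. b k w) n"

lemma energy_eq: "energy w n = (\<Sum>i\<in>indices n. (X i w)\<^sup>2)"
  by (simp add: sum_indices X_def energy_def)

lemma energy_measurable [measurable]: "(\<lambda>w. energy w n) \<in> borel_measurable M"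
  unfolding energy_eq by (intro borel_measurable_sum borel_measurable_power X_measurable)

lemma energy_nonneg: "0 \<le> energy w n"
  unfolding energy_def by (intro sum_nonneg) simp

text \<open>The squared coefficients have only a moment of order 3/2, so Chebyshev's inequality is not
  available; their bounded Laplace transform takes its place.\<close>
lemma laplace_energy:
  fixes \<theta> :: real
  assumes "\<theta> \<ge> 0"
  shows "\<bar>(\<integral>w. exp (- (\<theta>\<^sup>2 * energy w n)) \<partial>M) - exp (- (\<theta>\<^sup>2 * (2 * real n)))\<bar> \<le> 2 * real n * ((\<rho> + 1) * \<theta> ^ 3)"
proof -
  \<comment> \<open>The parameter is squared so that the pointwise inequality, applied to
    \<open>\<theta> * \<eta> w\<close>, has an error with expectation
    \<open>\<theta> ^ 3 * \<rho>\<close>.\<close>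
  define L where "L = (\<integral>w. exp (- (\<theta>\<^sup>2 * (\<eta> w)\<^sup>2)) \<partial>M)"
  have int: "integrable M (\<lambda>w. exp (- (\<theta>\<^sup>2 * (Y w)\<^sup>2)))" if [measurable]: "Y \<in> borel_measurable M" for Y
    by (intro integrable_const_bound[where B=1]) auto
  have L_bounds: "0 \<le> L" "L \<le> 1"
  proof -
    show "0 \<le> L" unfolding L_def by (rule integral_nonneg_AE) simp
    have "L \<le> (\<integral>w. 1 \<partial>M)"
      unfolding L_def using int[of \<eta>] by (intro integral_mono) auto
    then show "L \<le> 1" by (simp add: prob_space)
  qed
  have "L - (1 - \<theta>\<^sup>2) = (\<integral>w. exp (- (\<theta>\<^sup>2 * (\<eta> w)\<^sup>2)) - (1 - \<theta>\<^sup>2 * (\<eta> w)\<^sup>2) \<partial>M)"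
    using int[of \<eta>] \<eta>_integrable var' by (simp add: L_def prob_space)
  also have "\<bar>\<dots>\<bar> \<le> (\<integral>w. \<bar>exp (- (\<theta>\<^sup>2 * (\<eta> w)\<^sup>2)) - (1 - \<theta>\<^sup>2 * (\<eta> w)\<^sup>2)\<bar> \<partial>M)"
    by (rule integral_abs_bound)
  also have "\<dots> \<le> (\<integral>w. \<theta> ^ 3 * \<bar>\<eta> w\<bar> ^ 3 \<partial>M)"
  proof (rule integral_mono)
    show "\<bar>exp (- (\<theta>\<^sup>2 * (\<eta> w)\<^sup>2)) - (1 - \<theta>\<^sup>2 * (\<eta> w)\<^sup>2)\<bar> \<le> \<theta> ^ 3 * \<bar>\<eta> w\<bar> ^ 3" for w
      using abs_exp_minus_sq_le[of "\<theta> * \<eta> w"] assms by (simp add: power_mult_distrib abs_mult)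
  qed (use int[of \<eta>] \<eta>_integrable third' in auto)
  also have "\<dots> = \<theta> ^ 3 * \<rho>" by (simp add: \<rho>_def)
  finally have "\<bar>L - exp (- (\<theta>\<^sup>2))\<bar> \<le> (\<rho> + 1) * \<theta> ^ 3"
    using abs_exp_minus_sq_le[of \<theta>] assms by (simp add: algebra_simps abs_le_iff)
  then have diff: "norm (L - exp (- (\<theta>\<^sup>2))) \<le> (\<rho> + 1) * \<theta> ^ 3" by simp
  have "(\<integral>w. exp (- (\<theta>\<^sup>2 * energy w n)) \<partial>M) = (\<integral>w. (\<Prod>i\<in>indices n. exp (- (\<theta>\<^sup>2 * (X i w)\<^sup>2))) \<partial>M)"
    unfolding energy_eq by (simp add: sum_distrib_left sum_negf flip: exp_sum)
  also have "\<dots> = (\<Prod>i\<in>indices n. \<integral>w. exp (- (\<theta>\<^sup>2 * (X i w)\<^sup>2)) \<partial>M)"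
    by (intro indep_vars_lebesgue_integral int X_measurable
        indep_vars_compose2[OF X_indep, where Y="\<lambda>_ x. exp (- (\<theta>\<^sup>2 * x\<^sup>2))"]) auto
  also have "\<dots> = (\<Prod>i\<in>indices n. L)"
    unfolding L_def using X_integral[of _ n "\<lambda>x. exp (- (\<theta>\<^sup>2 * x\<^sup>2))"] by (intro prod.cong refl) auto
  finally have "(\<integral>w. exp (- (\<theta>\<^sup>2 * energy w n)) \<partial>M) = L ^ (2 * n)"
    by (simp add: card_indices)
  moreover have "exp (- (\<theta>\<^sup>2 * (2 * real n))) = exp (- (\<theta>\<^sup>2)) ^ (2 * n)"
    by (simp flip: exp_of_nat_mult)
  ultimately have "\<bar>(\<integral>w. exp (- (\<theta>\<^sup>2 * energy w n)) \<partial>M) - exp (- (\<theta>\<^sup>2 * (2 * real n)))\<bar>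
      = norm (L ^ (2 * n) - exp (- (\<theta>\<^sup>2)) ^ (2 * n))" by simp
  also have "\<dots> \<le> real (2 * n) * norm (L - exp (- (\<theta>\<^sup>2)))"
    using L_bounds by (intro norm_power_diff) auto
  also have "\<dots> \<le> real (2 * n) * ((\<rho> + 1) * \<theta> ^ 3)"
    using diff by (intro mult_left_mono) auto
  finally show ?thesis by simp
qed

text \<open>The random variable exp(-energy/m^4) has first and second moments given by the Laplace
  transform at two arguments. Both are within a multiple of 1/m^2 of those of the constant exp(-2),
  so the mean square distance to exp(-2) is summable. Taking logarithms recovers the energy.\<close>

lemma energy_fourth_powers: "AE w in M. (\<lambda>m. energy w (m ^ 4) / real (m ^ 4)) \<longlonglongrightarrow> 2"
proof -
  define Y where "Y m w = (exp (- (energy w (m ^ 4) / real (m ^ 4))) - exp (- 2))\<^sup>2" for m w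
  have [measurable]: "Y m \<in> borel_measurable M" for m unfolding Y_def by measurable
  have int_exp: "integrable M (\<lambda>w. exp (- (c * energy w n)))" if "c \<ge> 0" for c n
    using that energy_nonneg by (intro integrable_const_bound[where B=1]) auto
  have exp_sq: "(exp x)\<^sup>2 = exp (2 * x)" for x :: real
    by (simp add: exp_double)
  have Y_eq: "Y m w = exp (- (2 / real (m ^ 4) * energy w (m ^ 4)))
      - 2 * exp (- 2) * exp (- (1 / real (m ^ 4) * energy w (m ^ 4))) + exp (- 4)" for m w
    unfolding Y_def power2_diff exp_sq by simp
  have int: "integrable M (Y m)" for m
    unfolding Y_eq by (intro Bochner_Integration.integrable_add Bochner_Integration.integrable_diff
        integrable_mult_right int_exp integrable_const) auto
  have bound: "norm (\<integral>w. Y m w \<partial>M) \<le> 12 * (\<rho> + 1) * (1 / real m ^ 2)" if "m \<ge> 1" for m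
  proof -
    have m: "real m > 0" using that by simp
    define A where "A c = (\<integral>w. exp (- (c / real (m ^ 4) * energy w (m ^ 4))) \<partial>M)" for c
    \<comment> \<open>With \<theta> = c/m^2 the factor 2 m^4 times \<theta>^3 leaves 2 c^3 /
      m^2.\<close>
    have A: "\<bar>A (c\<^sup>2) - exp (- (c\<^sup>2 * 2))\<bar> \<le> 2 * c ^ 3 * (\<rho> + 1) * (1 / real m ^ 2)"
      if "c \<ge> 0" for c
    proof -
      have "(c / real m ^ 2)\<^sup>2 = c\<^sup>2 / real (m ^ 4)"
        by (simp add: power_divide flip: power_mult)
      then have "\<bar>A (c\<^sup>2) - exp (- (c\<^sup>2 / real (m ^ 4) * (2 * real (m ^ 4))))\<bar>
          \<le> 2 * real (m ^ 4) * ((\<rho> + 1) * (c / real m ^ 2) ^ 3)"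
        using laplace_energy[of "c / real m ^ 2" "m ^ 4"] that by (simp add: A_def)
      also have "c\<^sup>2 / real (m ^ 4) * (2 * real (m ^ 4)) = c\<^sup>2 * 2"
        using m by simp
      also have "2 * real (m ^ 4) * ((\<rho> + 1) * (c / real m ^ 2) ^ 3) = 2 * c ^ 3 * (\<rho> + 1) * (1 / real m ^ 2)"
      proof -
        have "real m ^ 4 * (c / real m ^ 2) ^ 3 = c ^ 3 * (1 / real m ^ 2)"
          using m by (simp add: power_divide power2_eq_square power3_eq_cube power4_eq_xxxx divide_simps)
        moreover have "2 * real (m ^ 4) * ((\<rho> + 1) * (c / real m ^ 2) ^ 3)
            = 2 * (\<rho> + 1) * (real m ^ 4 * (c / real m ^ 2) ^ 3)"
          by simp
        ultimately show ?thesis by (simp only: mult_ac)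
      qed
      finally show ?thesis .
    qed
    \<comment> \<open>The second moment is the case c = sqrt(2), and the crude bound 4 for its cube
      gives the constant 8; together with twice the constant 2 from c = 1 this makes 12.\<close>
    have "sqrt 2 \<le> 2" by (rule real_le_lsqrt) auto
    then have "sqrt 2 ^ 3 \<le> 4"
      by (simp add: power3_eq_cube)
    then have "2 * sqrt 2 ^ 3 * (\<rho> + 1) * (1 / real m ^ 2) \<le> 2 * 4 * (\<rho> + 1) * (1 / real m ^ 2)"
      using \<rho>_nonneg by (intro mult_right_mono) auto
    then have A2: "\<bar>A 2 - exp (- 4)\<bar> \<le> 8 * ((\<rho> + 1) * (1 / real m ^ 2))"
      using A[of "sqrt 2"] by simp
    have A1: "\<bar>A 1 - exp (- 2)\<bar> \<le> 2 * ((\<rho> + 1) * (1 / real m ^ 2))"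
      using A[of 1] by simp
    have "(\<integral>w. Y m w \<partial>M) = A 2 - 2 * exp (- 2) * A 1 + exp (- 4)"
      unfolding Y_eq A_def using int_exp[of "2 / real (m ^ 4)" "m ^ 4"] int_exp[of "1 / real (m ^ 4)" "m ^ 4"]
      by (simp add: prob_space)
    also have "\<dots> = (A 2 - exp (- 4)) - 2 * exp (- 2) * (A 1 - exp (- 2))"
      using exp_sq[of "- 2"] by (simp add: algebra_simps power2_eq_square)
    also have "norm \<dots> \<le> \<bar>A 2 - exp (- 4)\<bar> + \<bar>2 * exp (- 2) * (A 1 - exp (- 2))\<bar>"
      unfolding real_norm_def by (rule abs_triangle_ineq4)
    also have "\<dots> \<le> \<bar>A 2 - exp (- 4)\<bar> + 2 * \<bar>A 1 - exp (- 2)\<bar>"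
      by (simp add: abs_mult mult_left_le_one_le)
    also have "\<dots> \<le> 12 * ((\<rho> + 1) * (1 / real m ^ 2))"
      using A1 A2 by argo
    finally show ?thesis by (simp only: mult.assoc)
  qed
  have "summable (\<lambda>m. 12 * (\<rho> + 1) * (1 / real m ^ 2))"
    by (intro summable_mult inverse_power_summable[of 2, unfolded inverse_eq_divide]) auto
  then have "summable (\<lambda>m. \<integral>w. Y m w \<partial>M)"
    using bound by (rule summable_comparison_test')
  then have "AE w in M. (\<lambda>m. Y m w) \<longlonglongrightarrow> 0"
    by (intro AE_tendsto_0_if_summable_integral int) (simp add: Y_def)
  then show ?thesis
  proof eventually_elim
    case (elim w)
    have "(\<lambda>m. sqrt (Y m w)) \<longlonglongrightarrow> 0"
      using tendsto_real_sqrt[OF elim] by simp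
    then have "(\<lambda>m. exp (- (energy w (m ^ 4) / real (m ^ 4))) - exp (- 2)) \<longlonglongrightarrow> 0"
      unfolding Y_def real_sqrt_abs by (simp only: tendsto_rabs_zero_iff)
    then have "(\<lambda>m. exp (- (energy w (m ^ 4) / real (m ^ 4)))) \<longlonglongrightarrow> exp (- 2)"
      by (simp only: LIM_zero_iff)
    from tendsto_ln[OF this] have "(\<lambda>m. - (energy w (m ^ 4) / real (m ^ 4))) \<longlonglongrightarrow> - 2" by simp
    from tendsto_minus[OF this] show ?case by simp
  qed
qed

lemma energy_tendsto: "AE w in M. (\<lambda>n. energy w n / real n) \<longlonglongrightarrow> 2"
  using energy_fourth_powers
proof eventually_elim
  case (elim w)
  show ?case
  proof (rule fourth_powers_tendsto_imp_tendsto)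
    show "mono (energy w)"
      using mono_coeff_energy by (simp add: energy_def[abs_def])
    show "(\<lambda>m. energy w (m ^ 4) / real (m ^ 4)) \<longlonglongrightarrow> 2" by (rule elim)
  qed (rule energy_nonneg)
qed

end

subsection \<open>Almost sure convergence in law\<close>

text \<open>At a fixed point \<open>x\<close> the harmonic sum is a linear form in the independent
  variables; these are its weights, all of size at most 1/sqrt(n).\<close>

definition wave_coeff :: "nat \<Rightarrow> nat \<Rightarrow> real \<Rightarrow> nat + nat \<Rightarrow> real" where
  "wave_coeff p n x i = (case i of
      Inl k \<Rightarrow> (1 / sqrt (real n)) * ((real k / real n) ^ p * cos (real k * x + real p * pi / 2))
    | Inr k \<Rightarrow> (1 / sqrt (real n)) * ((real k / real n) ^ p * sin (real k * x + real p * pi / 2)))"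

lemma abs_wave_coeff_le:
  assumes "i \<in> indices n"
  shows "\<bar>wave_coeff p n x i\<bar> \<le> 1 / sqrt (real n)"
proof -
  have "\<bar>(1 / sqrt (real n)) * ((real k / real n) ^ p * c)\<bar> \<le> 1 / sqrt (real n)"
    if "k \<le> n" "\<bar>c\<bar> \<le> 1" for k c
  proof -
    have "\<bar>(real k / real n) ^ p * c\<bar> \<le> 1 * 1"
      unfolding abs_mult using that by (intro mult_mono) (auto simp: power_abs intro!: power_le_one divide_le_eq_1[THEN iffD2])
    then have "(1 / sqrt (real n)) * \<bar>(real k / real n) ^ p * c\<bar> \<le> (1 / sqrt (real n)) * 1"
      by (intro mult_left_mono) auto
    then show ?thesis by (simp add: abs_mult)
  qed
  then show ?thesis
    using assms by (auto simp: wave_coeff_def indices_def)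
qed

lemma sum_wave_coeff:
  "(\<Sum>i\<in>indices n. wave_coeff p n x i * (case i of Inl k \<Rightarrow> u k | Inr k \<Rightarrow> v k)) = harmonic_sum p n u v x"
  by (simp add: sum_indices wave_coeff_def harmonic_sum_def sum_distrib_left algebra_simps)

text \<open>The variance of the harmonic sum at any point \<open>x\<close> over the randomness of
  the coefficients. It is free of \<open>x\<close> because sine and cosine of each frequency occur
  together, and it is a Riemann sum of s^(2p) over [0,1].\<close>

definition wave_norm :: "nat \<Rightarrow> nat \<Rightarrow> real" where
  "wave_norm p n = (\<Sum>k=1..n. (real k / real n) ^ (2 * p)) / real n"

lemma sum_wave_coeff_sq: "(\<Sum>i\<in>indices n. (wave_coeff p n x i)\<^sup>2) = wave_norm p n"
proof -
  have "(1 / sqrt (real n) * (r ^ p * c))\<^sup>2 + (1 / sqrt (real n) * (r ^ p * s))\<^sup>2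
      = r ^ (2 * p) * (s\<^sup>2 + c\<^sup>2) / real n" for r c s :: real
    by (simp add: power_mult_distrib power_divide power_mult[symmetric] mult.commute[of p] add_divide_distrib distrib_left)
  then show ?thesis
    by (simp add: sum_indices wave_coeff_def wave_norm_def sum_divide_distrib)
qed

lemma wave_norm_0: "n > 0 \<Longrightarrow> wave_norm 0 n = 1"
  by (simp add: wave_norm_def)

lemma wave_norm_1_tendsto: "wave_norm 1 \<longlonglongrightarrow> 1 / 3"
proof -
  have sq: "(\<Sum>k=1..n. (real k)\<^sup>2) = real n * (real n + 1) * (2 * real n + 1) / 6" for n
    by (induction n) (simp_all add: field_simps power2_eq_square)
  have eq: "wave_norm 1 n = (1 + 1 / real n) * (2 + 1 / real n) / 6" if "n > 0" for n
  proof -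
    have "wave_norm 1 n = (\<Sum>k=1..n. (real k)\<^sup>2) / (real n)\<^sup>2 / real n"
      by (simp add: wave_norm_def power_divide sum_divide_distrib)
    also have "\<dots> = (1 + 1 / real n) * (2 + 1 / real n) / 6"
      unfolding sq using that by (simp add: field_simps power2_eq_square)
    finally show ?thesis .
  qed
  have "(\<lambda>n. (1 + 1 / real n) * (2 + 1 / real n) / 6) \<longlonglongrightarrow> (1 + 0) * (2 + 0) / 6"
    by (intro tendsto_intros lim_1_over_n) simp
  then have "(\<lambda>n. (1 + 1 / real n) * (2 + 1 / real n) / 6) \<longlonglongrightarrow> 1 / 3" by simp
  then show ?thesis
    by (rule Lim_transform_eventually)
      (use eq in \<open>auto intro!: eventually_mono[OF eventually_gt_at_top[of 0]]\<close>)
qed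

text \<open>The covariance of \<open>D(x)\<close> and \<open>D(y)\<close>. It is small only on average, not near the diagonal \<open>x = y\<close>.\<close>
definition wave_cov :: "nat \<Rightarrow> nat \<Rightarrow> real \<Rightarrow> real \<Rightarrow> real" where
  "wave_cov p n x y = (\<Sum>i\<in>indices n. wave_coeff p n x i * wave_coeff p n y i)"

text \<open>As a function of \<open>y\<close> the covariance is again a harmonic sum, with the
  weights at \<open>x\<close> as coefficients, so the orthogonality bound for averages over
  \<open>y\<close> is available.\<close>

lemma wave_cov_eq: "wave_cov p n x = harmonic_sum p n (\<lambda>k. wave_coeff p n x (Inl k)) (\<lambda>k. wave_coeff p n x (Inr k))"
  by (rule ext) (simp add: wave_cov_def sum_indices harmonic_sum_def wave_coeff_def sum_distrib_left algebra_simps)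

text \<open>The energy of this harmonic sum is \<open>wave_norm p n\<close>, at most 1, whereas
  typical coefficients have energy of order \<open>n\<close>: hence the gain of 1/sqrt(n).\<close>

lemma PX_abs_wave_cov_le:
  assumes "n > 0"
  shows "(\<integral>y. \<bar>wave_cov p n x y\<bar> \<partial>PX) \<le> 1 / sqrt (real n)"
proof -
  have "(\<Sum>k=1..n. (wave_coeff p n x (Inl k))\<^sup>2 + (wave_coeff p n x (Inr k))\<^sup>2) = wave_norm p n"
    using sum_wave_coeff_sq[of p n x] by (simp only: sum_indices)
  also have "\<dots> \<le> (\<Sum>k=1..n. 1) / real n"
    unfolding wave_norm_def by (intro divide_right_mono sum_mono power_le_one) auto
  also have "\<dots> = 1" using assms by simp
  finally have "(\<Sum>k=1..n. (wave_coeff p n x (Inl k))\<^sup>2 + (wave_coeff p n x (Inr k))\<^sup>2) / (2 * real n) \<le> 1 / real n"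
    using assms by (simp add: divide_simps)
  then have "sqrt ((\<Sum>k=1..n. (wave_coeff p n x (Inl k))\<^sup>2 + (wave_coeff p n x (Inr k))\<^sup>2) / (2 * real n)) \<le> sqrt (1 / real n)"
    by (rule real_sqrt_le_mono)
  then show ?thesis
    unfolding wave_cov_eq
    using PX_abs_harmonic_sum_le[of p n "\<lambda>k. wave_coeff p n x (Inl k)" "\<lambda>k. wave_coeff p n x (Inr k)"]
    by (simp add: real_sqrt_divide)
qed

lemma PX_integrable_wave_cov: "integrable PX (\<lambda>y. \<bar>wave_cov p n x y\<bar>)"
  unfolding wave_cov_eq by (intro PX_integrable_continuous continuous_intros)

text \<open>Turns an estimate at each point \<open>x\<close> into one for the average over
  \<open>x\<close>. The bound may depend on \<open>x\<close>, as it must for the covariance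
  term.\<close>

lemma (in prob_space) PX_Fubini_bound:
  fixes f :: "'a \<Rightarrow> real \<Rightarrow> complex"
  assumes [measurable]: "case_prod f \<in> borel_measurable (M \<Otimes>\<^sub>M borel)"
    and le: "\<And>w x. norm (f w x) \<le> 1"
    and bound: "\<And>x. norm ((\<integral>w. f w x \<partial>M) - c) \<le> B x" and B: "integrable PX B"
  shows "norm ((\<integral>w. (\<integral>x. f w x \<partial>PX) \<partial>M) - c) \<le> (\<integral>x. B x \<partial>PX)"
proof -
  interpret P: pair_prob_space M PX ..
  have [measurable]: "case_prod f \<in> borel_measurable (M \<Otimes>\<^sub>M PX)"
    using assms(1) by (simp cong: measurable_cong_sets sets_pair_measure_cong)
  have int: "integrable (M \<Otimes>\<^sub>M PX) (case_prod f)"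
    using le by (intro P.integrable_const_bound[where B=1]) auto
  have "(\<integral>w. (\<integral>x. f w x \<partial>PX) \<partial>M) = (\<integral>x. (\<integral>w. f w x \<partial>M) \<partial>PX)"
    by (rule P.Fubini_integral[OF int, symmetric])
  then have "(\<integral>w. (\<integral>x. f w x \<partial>PX) \<partial>M) - c = (\<integral>x. (\<integral>w. f w x \<partial>M) - c \<partial>PX)"
    using P.integrable_snd[OF int] by (simp add: PX.prob_space[simplified])
  also have "norm \<dots> \<le> (\<integral>x. norm ((\<integral>w. f w x \<partial>M) - c) \<partial>PX)"
    by (rule integral_norm_bound)
  also have "\<dots> \<le> (\<integral>x. B x \<partial>PX)"
    using P.integrable_snd[OF int] B bound by (intro integral_mono) auto
  finally show ?thesis .
qed

lemma iexp_mult: "iexp x * iexp y = iexp (x + y)"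
  by (simp add: distrib_left exp_add)

lemma cnj_iexp: "cnj (iexp x) = iexp (- x)"
  by (simp add: exp_cnj)

lemma borel_measurable_cnj [measurable (raw)]:
  "f \<in> borel_measurable M \<Longrightarrow> (\<lambda>x. cnj (f x)) \<in> borel_measurable M"
  by (rule measurable_compose[where g=cnj]) (auto intro!: borel_measurable_continuous_onI continuous_intros)

section \<open>Variance of the random characteristic function\<close>

context iid_coefficients
begin

abbreviation H :: "nat \<Rightarrow> nat \<Rightarrow> 'a \<Rightarrow> real \<Rightarrow> real" where
  "H p n w \<equiv> harmonic_sum p n (\<lambda>k. a k w) (\<lambda>k. b k w)"

lemma H_eq: "H p n w x = (\<Sum>i\<in>indices n. wave_coeff p n x i * X i w)"
  unfolding sum_wave_coeff[symmetric] X_def by (intro sum.cong refl) (simp split: sum.split)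

lemma H_measurable [measurable]:
  "(\<lambda>(w, x). H p n w x) \<in> borel_measurable (M \<Otimes>\<^sub>M borel)"
proof -
  have *: "a k \<in> borel_measurable M" "b k \<in> borel_measurable M" if "k \<in> {1..n}" for k
    using rv[of k] that by auto
  have [measurable]: "(\<lambda>z. a k (fst z)) \<in> borel_measurable (M \<Otimes>\<^sub>M borel)"
    "(\<lambda>z. b k (fst z)) \<in> borel_measurable (M \<Otimes>\<^sub>M borel)" if "k \<in> {1..n}" for k
    using *[OF that] by auto
  show ?thesis
    unfolding harmonic_sum_def case_prod_beta
    by (intro borel_measurable_times borel_measurable_const borel_measurable_sum borel_measurable_add) measurable
qed

lemma H_measurable_left: "(\<lambda>w. H p n w x) \<in> borel_measurable M"
  unfolding H_eq by (intro borel_measurable_sum borel_measurable_times borel_measurable_const X_measurable)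

text \<open>The characteristic function at \<xi> of the law of the harmonic sum under
  \<open>PX\<close> with coefficients frozen at \<open>w\<close>; as a function of \<open>w\<close>
  it is random.\<close>

definition Z :: "nat \<Rightarrow> real \<Rightarrow> nat \<Rightarrow> 'a \<Rightarrow> complex" where
  "Z p \<xi> n w = (\<integral>x. iexp (\<xi> * H p n w x) \<partial>PX)"

lemma Z_measurable [measurable]: "Z p \<xi> n \<in> borel_measurable M"
  unfolding Z_def using H_measurable[of p n] by measurable

lemma norm_Z_le: "norm (Z p \<xi> n w) \<le> 1"
proof -
  have "norm (Z p \<xi> n w) \<le> (\<integral>x. norm (iexp (\<xi> * H p n w x)) \<partial>PX)"
    unfolding Z_def by (rule integral_norm_bound)
  then show ?thesis by (simp add: PX.prob_space[simplified])
qed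

definition gauss_char :: "nat \<Rightarrow> real \<Rightarrow> nat \<Rightarrow> real" where
  "gauss_char p \<xi> n = exp (- (\<xi>\<^sup>2 * wave_norm p n) / 2)"

lemma gauss_char_bounds: "0 \<le> gauss_char p \<xi> n" "gauss_char p \<xi> n \<le> 1"
  by (auto simp: gauss_char_def wave_norm_def intro!: sum_nonneg divide_nonneg_nonneg mult_nonneg_nonneg)

text \<open>The constant 16 is 2 * 2^3: there are \<open>2 * n\<close> weights, and each is a
  difference of two and hence at most 2 |\<xi>| / sqrt(n). The term \<open>\<xi>\<^sup>2\<close>
  pays for the averaged covariance.\<close>

definition rate :: "real \<Rightarrow> nat \<Rightarrow> real" where
  "rate \<xi> n = (16 * (\<rho> + 1) * \<bar>\<xi>\<bar> ^ 3 + \<xi>\<^sup>2) * (1 / sqrt (real n))"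

lemma sum_cubes_le:
  assumes "n > 0" "\<And>i. i \<in> indices n \<Longrightarrow> \<bar>s i\<bar> \<le> c * (1 / sqrt (real n))" "0 \<le> c"
  shows "(\<Sum>i\<in>indices n. \<bar>s i\<bar> ^ 3) \<le> 2 * c ^ 3 * (1 / sqrt (real n))"
proof -
  have "(\<Sum>i\<in>indices n. \<bar>s i\<bar> ^ 3) \<le> (\<Sum>i\<in>indices n. (c * (1 / sqrt (real n))) ^ 3)"
    using assms(2) by (intro sum_mono power_mono) auto
  also have "\<dots> = 2 * real n * (c * (1 / sqrt (real n))) ^ 3"
    by (simp add: card_indices)
  also have "\<dots> = 2 * c ^ 3 * (real n * (1 / sqrt (real n) * (1 / sqrt (real n)))) * (1 / sqrt (real n))"
    by (simp add: power3_eq_cube mult_ac)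
  also have "real n * (1 / sqrt (real n) * (1 / sqrt (real n))) = 1"
    using assms(1) by simp
  finally show ?thesis by simp
qed

lemma one_point:
  assumes "n > 0"
  shows "cmod ((\<integral>w. iexp (\<xi> * H p n w x) \<partial>M) - gauss_char p \<xi> n) \<le> 2 * (\<rho> + 1) * \<bar>\<xi>\<bar> ^ 3 * (1 / sqrt (real n))"
proof -
  define s where "s i = \<xi> * wave_coeff p n x i" for i
  have eq: "\<xi> * H p n w x = (\<Sum>i\<in>indices n. s i * X i w)" for w
    by (simp only: H_eq s_def sum_distrib_left mult.assoc)
  have sq: "(\<Sum>i\<in>indices n. (s i)\<^sup>2) = \<xi>\<^sup>2 * wave_norm p n"
    by (simp add: s_def power_mult_distrib flip: sum_distrib_left sum_wave_coeff_sq[of p n x])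
  have "cmod ((\<integral>w. iexp (\<xi> * H p n w x) \<partial>M) - gauss_char p \<xi> n) \<le> (\<rho> + 1) * (\<Sum>i\<in>indices n. \<bar>s i\<bar> ^ 3)"
    unfolding gauss_char_def eq using iexp_linear_combination_approx[of s n] unfolding sq .
  also have "\<dots> \<le> (\<rho> + 1) * (2 * \<bar>\<xi>\<bar> ^ 3 * (1 / sqrt (real n)))"
  proof (intro mult_left_mono sum_cubes_le assms)
    show "\<bar>s i\<bar> \<le> \<bar>\<xi>\<bar> * (1 / sqrt (real n))" if "i \<in> indices n" for i
      unfolding s_def abs_mult by (intro mult_left_mono abs_wave_coeff_le that) simp
  qed (use \<rho>_nonneg in auto)
  finally show ?thesis by (simp only: mult_ac)
qed

text \<open>The difference of the values at \<open>x\<close> and \<open>y\<close> is one linear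
  form, whose variance is twice \<open>wave_norm p n\<close> minus twice the covariance. Without the
  covariance its Gaussian characteristic function would be exactly
  \<open>(gauss_char p \<xi> n)\<^sup>2\<close>.\<close>

lemma two_points:
  assumes "n > 0"
  shows "cmod ((\<integral>w. iexp (\<xi> * H p n w x) * iexp (- (\<xi> * H p n w y)) \<partial>M) - (gauss_char p \<xi> n)\<^sup>2)
    \<le> 16 * (\<rho> + 1) * \<bar>\<xi>\<bar> ^ 3 * (1 / sqrt (real n)) + \<xi>\<^sup>2 * \<bar>wave_cov p n x y\<bar>"
proof -
  define s where "s i = \<xi> * wave_coeff p n x i - \<xi> * wave_coeff p n y i" for i
  have "\<xi> * H p n w x + - (\<xi> * H p n w y) = (\<Sum>i\<in>indices n. s i * X i w)" for w
    by (simp add: H_eq s_def sum_distrib_left sum_subtractf left_diff_distrib mult.assoc)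
  then have eq: "iexp (\<xi> * H p n w x) * iexp (- (\<xi> * H p n w y)) = iexp (\<Sum>i\<in>indices n. s i * X i w)" for w
    unfolding iexp_mult by (rule arg_cong)
  have sq: "(\<Sum>i\<in>indices n. (s i)\<^sup>2) = 2 * (\<xi>\<^sup>2 * wave_norm p n) - 2 * (\<xi>\<^sup>2 * wave_cov p n x y)"
  proof -
    have "(s i)\<^sup>2 = \<xi>\<^sup>2 * (wave_coeff p n x i)\<^sup>2 + \<xi>\<^sup>2 * (wave_coeff p n y i)\<^sup>2
        - 2 * \<xi>\<^sup>2 * (wave_coeff p n x i * wave_coeff p n y i)" for i
      by (simp add: s_def power2_eq_square algebra_simps)
    then have "(\<Sum>i\<in>indices n. (s i)\<^sup>2) = \<xi>\<^sup>2 * (\<Sum>i\<in>indices n. (wave_coeff p n x i)\<^sup>2)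
        + \<xi>\<^sup>2 * (\<Sum>i\<in>indices n. (wave_coeff p n y i)\<^sup>2) - 2 * \<xi>\<^sup>2 * wave_cov p n x y"
      by (simp only: sum_subtractf sum.distrib wave_cov_def sum_distrib_left)
    then show ?thesis by (simp add: sum_wave_coeff_sq)
  qed
  have cubes: "(\<rho> + 1) * (\<Sum>i\<in>indices n. \<bar>s i\<bar> ^ 3) \<le> (\<rho> + 1) * (2 * (2 * \<bar>\<xi>\<bar>) ^ 3 * (1 / sqrt (real n)))"
  proof (intro mult_left_mono sum_cubes_le assms)
    fix i assume i: "i \<in> indices n"
    have "\<bar>wave_coeff p n x i - wave_coeff p n y i\<bar> \<le> 2 * (1 / sqrt (real n))"
      using abs_wave_coeff_le[OF i, of p x] abs_wave_coeff_le[OF i, of p y] by linarith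
    then have "\<bar>\<xi>\<bar> * \<bar>wave_coeff p n x i - wave_coeff p n y i\<bar> \<le> \<bar>\<xi>\<bar> * (2 * (1 / sqrt (real n)))"
      by (intro mult_left_mono) auto
    then show "\<bar>s i\<bar> \<le> 2 * \<bar>\<xi>\<bar> * (1 / sqrt (real n))"
      unfolding s_def right_diff_distrib[symmetric] abs_mult by (simp only: mult_ac)
  qed (use \<rho>_nonneg in auto)
  have 1: "cmod ((\<integral>w. iexp (\<xi> * H p n w x) * iexp (- (\<xi> * H p n w y)) \<partial>M)
      - exp (- (\<Sum>i\<in>indices n. (s i)\<^sup>2) / 2)) \<le> 16 * (\<rho> + 1) * \<bar>\<xi>\<bar> ^ 3 * (1 / sqrt (real n))"
  proof -
    have "(\<rho> + 1) * (2 * (2 * \<bar>\<xi>\<bar>) ^ 3 * (1 / sqrt (real n))) = 16 * (\<rho> + 1) * \<bar>\<xi>\<bar> ^ 3 * (1 / sqrt (real n))"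
      by (simp add: power_mult_distrib)
    then show ?thesis
      unfolding eq using order_trans[OF iexp_linear_combination_approx cubes] by (simp only:)
  qed
  \<comment> \<open>The constant 1 is valid on the half-line only; both exponents are nonnegative
    because they are sums of squares.\<close>
  have exp_Lipschitz: "\<bar>exp (- x) - exp (- y)\<bar> \<le> \<bar>x - y\<bar>" if "0 \<le> x" "0 \<le> y" for x y :: real
  proof -
    have "\<bar>exp (- x) - exp (- y)\<bar> \<le> 1 * \<bar>x - y\<bar>"
      unfolding real_norm_def[symmetric]
    proof (rule field_differentiable_bound[where S="{0..}" and f'="\<lambda>z. - exp (- z)"])
      show "((\<lambda>z. exp (- z)) has_real_derivative - exp (- z)) (at z within {0..})" for z
        by (rule has_field_derivative_at_within) (auto intro!: derivative_eq_intros)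
    qed (use that in auto)
    then show ?thesis by simp
  qed
  have nonneg: "0 \<le> (\<Sum>i\<in>indices n. (s i)\<^sup>2) / 2" "0 \<le> \<xi>\<^sup>2 * wave_norm p n"
    by (auto intro!: sum_nonneg mult_nonneg_nonneg simp flip: sum_wave_coeff_sq[of p n x])
  have "(gauss_char p \<xi> n)\<^sup>2 = exp (- (\<xi>\<^sup>2 * wave_norm p n))"
    by (simp add: gauss_char_def power2_eq_square flip: exp_add)
  then have "\<bar>exp (- (\<Sum>i\<in>indices n. (s i)\<^sup>2) / 2) - (gauss_char p \<xi> n)\<^sup>2\<bar>
      \<le> \<bar>(\<Sum>i\<in>indices n. (s i)\<^sup>2) / 2 - \<xi>\<^sup>2 * wave_norm p n\<bar>"
    using exp_Lipschitz[OF nonneg] by simp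
  also have "\<dots> = \<bar>- (\<xi>\<^sup>2 * wave_cov p n x y)\<bar>"
    unfolding sq by (rule arg_cong[where f=abs]) (simp add: diff_divide_distrib)
  also have "\<dots> = \<xi>\<^sup>2 * \<bar>wave_cov p n x y\<bar>"
    by (simp add: abs_mult)
  finally have 2: "cmod (complex_of_real (exp (- (\<Sum>i\<in>indices n. (s i)\<^sup>2) / 2)) - (gauss_char p \<xi> n)\<^sup>2)
      \<le> \<xi>\<^sup>2 * \<bar>wave_cov p n x y\<bar>"
    by (simp only: norm_of_real flip: of_real_diff of_real_power)
  show ?thesis
    by (rule norm_diff_triangle_le[OF 1 2])
qed

lemma integral_Z:
  assumes "n > 0"
  shows "cmod ((\<integral>w. Z p \<xi> n w \<partial>M) - gauss_char p \<xi> n) \<le> 2 * (\<rho> + 1) * \<bar>\<xi>\<bar> ^ 3 * (1 / sqrt (real n))"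
proof -
  have "cmod ((\<integral>w. Z p \<xi> n w \<partial>M) - gauss_char p \<xi> n)
      \<le> (\<integral>x. 2 * (\<rho> + 1) * \<bar>\<xi>\<bar> ^ 3 * (1 / sqrt (real n)) \<partial>PX)"
    unfolding Z_def using H_measurable[of p n]
    by (intro PX_Fubini_bound one_point assms) (auto simp: PX.integrable_const)
  then show ?thesis by (simp add: PX.prob_space[simplified])
qed

text \<open>The square of the modulus of \<open>Z\<close> is a double average over \<open>x\<close>
  and \<open>y\<close>; this is the average over \<open>y\<close> at fixed \<open>x\<close>. The
  covariance contributes 1/sqrt(n) whatever \<open>x\<close> is, so the remaining average over
  \<open>x\<close> costs nothing.\<close>

lemma integral_iexp_cnj_Z:
  assumes "n > 0"
  shows "cmod ((\<integral>w. iexp (\<xi> * H p n w x) * cnj (Z p \<xi> n w) \<partial>M) - (gauss_char p \<xi> n)\<^sup>2) \<le> rate \<xi> n"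
proof -
  define K where "K = 16 * (\<rho> + 1) * \<bar>\<xi>\<bar> ^ 3 * (1 / sqrt (real n))"
  note [measurable] = H_measurable[of p n] H_measurable_left[of p n x]
  have eq: "iexp (\<xi> * H p n w x) * cnj (Z p \<xi> n w) = (\<integral>y. iexp (\<xi> * H p n w x) * iexp (- (\<xi> * H p n w y)) \<partial>PX)" for w
  proof -
    have "cnj (Z p \<xi> n w) = (\<integral>y. iexp (- (\<xi> * H p n w y)) \<partial>PX)"
      unfolding Z_def Bochner_Integration.integral_cnj[symmetric] cnj_iexp ..
    then show ?thesis by (simp only: integral_mult_right_zero)
  qed
  have "cmod ((\<integral>w. iexp (\<xi> * H p n w x) * cnj (Z p \<xi> n w) \<partial>M) - (gauss_char p \<xi> n)\<^sup>2)
      = cmod ((\<integral>w. (\<integral>y. iexp (\<xi> * H p n w x) * iexp (- (\<xi> * H p n w y)) \<partial>PX) \<partial>M) - (gauss_char p \<xi> n)\<^sup>2)"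
    by (simp only: eq)
  also have "\<dots> \<le> (\<integral>y. K + \<xi>\<^sup>2 * \<bar>wave_cov p n x y\<bar> \<partial>PX)"
    unfolding K_def
  proof (rule PX_Fubini_bound[OF _ _ two_points[OF assms]])
    show "(\<lambda>(w, y). iexp (\<xi> * H p n w x) * iexp (- (\<xi> * H p n w y))) \<in> borel_measurable (M \<Otimes>\<^sub>M borel)"
      by measurable
  qed (auto simp: norm_mult intro!: PX_integrable_wave_cov)
  also have "\<dots> = K + \<xi>\<^sup>2 * (\<integral>y. \<bar>wave_cov p n x y\<bar> \<partial>PX)"
    using PX_integrable_wave_cov[of p n x] by (simp add: PX.prob_space[simplified])
  also have "\<dots> \<le> K + \<xi>\<^sup>2 * (1 / sqrt (real n))"
    using PX_abs_wave_cov_le[OF assms] by (intro add_left_mono mult_left_mono) auto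
  finally show ?thesis by (simp add: K_def rate_def algebra_simps)
qed

lemma integral_Z_cnj_Z:
  assumes "n > 0"
  shows "cmod ((\<integral>w. Z p \<xi> n w * cnj (Z p \<xi> n w) \<partial>M) - (gauss_char p \<xi> n)\<^sup>2) \<le> rate \<xi> n"
proof -
  note [measurable] = H_measurable[of p n]
  have eq: "Z p \<xi> n w * cnj (Z p \<xi> n w) = (\<integral>x. iexp (\<xi> * H p n w x) * cnj (Z p \<xi> n w) \<partial>PX)" for w
    unfolding Z_def by (rule integral_mult_left_zero[symmetric])
  have "cmod ((\<integral>w. Z p \<xi> n w * cnj (Z p \<xi> n w) \<partial>M) - (gauss_char p \<xi> n)\<^sup>2)
      = cmod ((\<integral>w. (\<integral>x. iexp (\<xi> * H p n w x) * cnj (Z p \<xi> n w) \<partial>PX) \<partial>M) - (gauss_char p \<xi> n)\<^sup>2)"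
    by (simp only: eq)
  also have "\<dots> \<le> (\<integral>x. rate \<xi> n \<partial>PX)"
  proof (rule PX_Fubini_bound[OF _ _ integral_iexp_cnj_Z[OF assms]])
    show "(\<lambda>(w, x). iexp (\<xi> * H p n w x) * cnj (Z p \<xi> n w)) \<in> borel_measurable (M \<Otimes>\<^sub>M borel)"
      by measurable
  qed (auto simp: norm_mult norm_Z_le PX.integrable_const)
  finally show ?thesis by (simp add: PX.prob_space[simplified])
qed

text \<open>The target \<open>gauss_char p \<xi> n\<close> is deterministic, so expanding the square
  leaves the second moment and the mean of \<open>Z\<close>, each already compared with its Gaussian
  value.\<close>

lemma variance_Z:
  assumes "n > 0"
  shows "(\<integral>w. (cmod (Z p \<xi> n w - gauss_char p \<xi> n))\<^sup>2 \<partial>M) \<le> 2 * rate \<xi> n"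
proof -
  define e where "e = gauss_char p \<xi> n"
  have intZ: "integrable M (Z p \<xi> n)" "integrable M (\<lambda>w. Z p \<xi> n w * cnj (Z p \<xi> n w))"
    using norm_Z_le by (auto intro!: integrable_const_bound[where B=1] simp: norm_mult mult_le_one)
  have "(cmod (Z p \<xi> n w - e))\<^sup>2 = Re (Z p \<xi> n w * cnj (Z p \<xi> n w)) - 2 * e * Re (Z p \<xi> n w) + e\<^sup>2" for w
    unfolding cmod_power2 by (simp add: power2_eq_square algebra_simps)
  then have "(\<integral>w. (cmod (Z p \<xi> n w - e))\<^sup>2 \<partial>M)
      = (\<integral>w. Re (Z p \<xi> n w * cnj (Z p \<xi> n w)) - 2 * e * Re (Z p \<xi> n w) + e\<^sup>2 \<partial>M)"
    by presburger
  also have "\<dots> = Re (\<integral>w. Z p \<xi> n w * cnj (Z p \<xi> n w) \<partial>M) - 2 * e * Re (\<integral>w. Z p \<xi> n w \<partial>M) + e\<^sup>2"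
    using intZ by (simp only: Bochner_Integration.integral_add Bochner_Integration.integral_diff
        integrable_Re integral_Re integrable_mult_right integral_mult_right_zero integrable_const
        Bochner_Integration.integrable_diff) (simp add: prob_space)
  \<comment> \<open>Regrouped so that the squares of \<open>e\<close> cancel and only the two small
    differences remain.\<close>
  also have "\<dots> = Re ((\<integral>w. Z p \<xi> n w * cnj (Z p \<xi> n w) \<partial>M) - (e :: complex)\<^sup>2)
      - 2 * e * Re ((\<integral>w. Z p \<xi> n w \<partial>M) - e)"
    by (simp add: power2_eq_square algebra_simps)
  also have "\<dots> \<le> rate \<xi> n + 2 * 1 * (2 * (\<rho> + 1) * \<bar>\<xi>\<bar> ^ 3 * (1 / sqrt (real n)))"
  proof -
    have A: "Re ((\<integral>w. Z p \<xi> n w * cnj (Z p \<xi> n w) \<partial>M) - (e :: complex)\<^sup>2) \<le> rate \<xi> n"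
      using order_trans[OF complex_Re_le_cmod integral_Z_cnj_Z[OF assms, of p \<xi>]] by (simp add: e_def)
    have B: "\<bar>Re ((\<integral>w. Z p \<xi> n w \<partial>M) - e)\<bar> \<le> 2 * (\<rho> + 1) * \<bar>\<xi>\<bar> ^ 3 * (1 / sqrt (real n))"
      using order_trans[OF abs_Re_le_cmod integral_Z[OF assms, of p \<xi>]] by (simp add: e_def)
    have "\<bar>2 * e * Re ((\<integral>w. Z p \<xi> n w \<partial>M) - e)\<bar> \<le> 2 * 1 * (2 * (\<rho> + 1) * \<bar>\<xi>\<bar> ^ 3 * (1 / sqrt (real n)))"
      unfolding abs_mult using gauss_char_bounds[of p \<xi> n] B by (intro mult_mono) (auto simp: e_def)
    then show ?thesis using A by linarith
  qed
  also have "\<dots> \<le> 2 * rate \<xi> n"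
  proof -
    have "2 * 1 * (2 * (\<rho> + 1) * \<bar>\<xi>\<bar> ^ 3 * (1 / sqrt (real n))) \<le> rate \<xi> n"
    proof -
      have "0 \<le> (\<rho> + 1) * \<bar>\<xi>\<bar> ^ 3" using \<rho>_nonneg by simp
      then have "4 * ((\<rho> + 1) * \<bar>\<xi>\<bar> ^ 3) \<le> 16 * ((\<rho> + 1) * \<bar>\<xi>\<bar> ^ 3) + \<xi>\<^sup>2"
        using zero_le_power2[of \<xi>] by linarith
      then have "4 * ((\<rho> + 1) * \<bar>\<xi>\<bar> ^ 3) * (1 / sqrt (real n))
          \<le> (16 * ((\<rho> + 1) * \<bar>\<xi>\<bar> ^ 3) + \<xi>\<^sup>2) * (1 / sqrt (real n))"
        by (rule mult_right_mono) simp
      then show ?thesis by (simp add: rate_def mult.assoc del: distrib_left_numeral)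
    qed
    then show ?thesis by simp
  qed
  finally show ?thesis by (simp add: e_def)
qed

text \<open>At n = m^4 the variance bound is a multiple of 1/m^2. The centring
  \<open>gauss_char\<close> still depends on \<open>m\<close>; its limit comes from that of
  \<open>wave_norm p\<close>.\<close>

lemma Z_fourth_powers:
  assumes lim: "wave_norm p \<longlonglongrightarrow> \<sigma>\<^sup>2"
  shows "AE w in M. (\<lambda>m. Z p \<xi> (m ^ 4) w) \<longlonglongrightarrow> exp (- ((\<sigma> * \<xi>)\<^sup>2) / 2)"
proof -
  define Y where "Y m w = (cmod (Z p \<xi> (m ^ 4) w - gauss_char p \<xi> (m ^ 4)))\<^sup>2" for m w
  have [measurable]: "Y m \<in> borel_measurable M" for m unfolding Y_def by measurable
  have int: "integrable M (Y m)" for m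
  proof (rule integrable_const_bound)
    have "cmod (Z p \<xi> (m ^ 4) w - gauss_char p \<xi> (m ^ 4)) \<le> 2" for w
      using norm_triangle_ineq4[of "Z p \<xi> (m ^ 4) w" "gauss_char p \<xi> (m ^ 4)"]
        norm_Z_le[of p \<xi> "m ^ 4" w] gauss_char_bounds[of p \<xi> "m ^ 4"] by simp
    then have "Y m w \<le> 2\<^sup>2" for w
      unfolding Y_def by (intro power_mono) auto
    moreover have "norm (Y m w) = Y m w" for w
      by (simp add: Y_def)
    ultimately show "AE w in M. norm (Y m w) \<le> 2\<^sup>2"
      by (intro AE_I2) simp
  qed measurable
  have bound: "norm (\<integral>w. Y m w \<partial>M) \<le> 2 * (16 * (\<rho> + 1) * \<bar>\<xi>\<bar> ^ 3 + \<xi>\<^sup>2) * (1 / real m ^ 2)" if "m \<ge> 1" for m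
  proof -
    have "sqrt (real (m ^ 4)) = real m ^ 2"
      by (rule real_sqrt_unique) (simp_all flip: power_mult)
    then show ?thesis
      using variance_Z[of "m ^ 4" p \<xi>] that by (simp add: Y_def rate_def)
  qed
  have "summable (\<lambda>m. 2 * (16 * (\<rho> + 1) * \<bar>\<xi>\<bar> ^ 3 + \<xi>\<^sup>2) * (1 / real m ^ 2))"
    by (intro summable_mult inverse_power_summable[of 2, unfolded inverse_eq_divide]) auto
  then have "summable (\<lambda>m. \<integral>w. Y m w \<partial>M)"
    using bound by (rule summable_comparison_test')
  then have "AE w in M. (\<lambda>m. Y m w) \<longlonglongrightarrow> 0"
    by (intro AE_tendsto_0_if_summable_integral int) (simp add: Y_def)
  then show ?thesis
  proof eventually_elim
    case (elim w)
    have "(\<lambda>m. sqrt (Y m w)) \<longlonglongrightarrow> 0"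
      using tendsto_real_sqrt[OF elim] by simp
    then have 1: "(\<lambda>m. Z p \<xi> (m ^ 4) w - gauss_char p \<xi> (m ^ 4)) \<longlonglongrightarrow> 0"
      unfolding Y_def by (simp add: tendsto_norm_zero_iff)
    have "filterlim (\<lambda>m::nat. m ^ 4) at_top sequentially"
      using eventually_gt_at_top[of 0]
      by (intro filterlim_at_top_mono[OF filterlim_ident], eventually_elim)
        (auto intro!: self_le_power simp: Suc_le_eq)
    then have "(\<lambda>m. wave_norm p (m ^ 4)) \<longlonglongrightarrow> \<sigma>\<^sup>2"
      by (rule filterlim_compose[OF lim])
    then have "(\<lambda>m. gauss_char p \<xi> (m ^ 4)) \<longlonglongrightarrow> exp (- (\<xi>\<^sup>2 * \<sigma>\<^sup>2) / 2)"
      unfolding gauss_char_def by (intro tendsto_intros) auto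
    then have 2: "(\<lambda>m. complex_of_real (gauss_char p \<xi> (m ^ 4))) \<longlonglongrightarrow> complex_of_real (exp (- (\<xi>\<^sup>2 * \<sigma>\<^sup>2) / 2))"
      by (rule tendsto_of_real)
    from tendsto_add[OF 1 2] show ?case by (simp add: power_mult_distrib mult.commute)
  qed
qed

text \<open>Each frequency has its own null set; restricting to rational ones leaves a countable
  union, and the deterministic criterion is applied outside it.\<close>

lemma AE_weak_conv:
  assumes lim: "wave_norm p \<longlonglongrightarrow> \<sigma>\<^sup>2"
  shows "AE w in M. weak_conv_m (\<lambda>n. distr PX borel (H p n w)) (normal_law \<sigma>)"
proof -
  have "AE w in M. \<forall>q\<in>\<rat>. (\<lambda>m. Z p q (m ^ 4) w) \<longlonglongrightarrow> exp (- ((\<sigma> * q)\<^sup>2) / 2)"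
    using Z_fourth_powers[OF lim] by (simp add: AE_ball_countable countable_rat)
  with energy_tendsto show ?thesis
  proof eventually_elim
    case (elim w)
    show ?case
    proof (rule weak_conv_harmonic_sum)
      show "(\<lambda>n. coeff_energy (\<lambda>k. a k w) (\<lambda>k. b k w) n / real n) \<longlonglongrightarrow> 2"
        using elim(1) by (simp add: energy_def)
      show "(\<lambda>m. char (distr PX borel (H p (m ^ 4) w)) q) \<longlonglongrightarrow> exp (- ((\<sigma> * q)\<^sup>2) / 2)"
        if "q \<in> \<rat>" for q
        using elim(2) that by (simp add: char_distr_PX Z_def)
    qed
  qed
qed

theorem AE_dTV_X_tendsto_0:
  "AE w in M. \<forall>g. g \<in> borel_measurable PX \<and> distr PX borel g = std_normal_distribution \<longrightarrow>
     (\<lambda>n. dTV_X PX (trig_poly a b n w) g) \<longlonglongrightarrow> 0"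
proof -
  have lim0: "wave_norm 0 \<longlonglongrightarrow> 1\<^sup>2"
    by (rule tendsto_eventually) (auto intro!: eventually_mono[OF eventually_gt_at_top[of 0]] simp: wave_norm_0)
  have lim1: "wave_norm 1 \<longlonglongrightarrow> (sqrt (1 / 3))\<^sup>2"
    using wave_norm_1_tendsto by simp
  show ?thesis
    using AE_weak_conv[OF lim0] AE_weak_conv[OF lim1] energy_tendsto
  proof eventually_elim
    case (elim w)
    have "Bseq (\<lambda>n. energy w n / real n)"
      using elim(3) by (intro convergent_imp_Bseq) (auto simp: convergent_def)
    then obtain K where K: "K > 0" "\<And>n. norm (energy w n / real n) \<le> K"
      by (auto simp: Bseq_def)
    have energy_le: "coeff_energy (\<lambda>k. a k w) (\<lambda>k. b k w) n \<le> K * real n" for n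
    \<comment> \<open>The bound \<open>K\<close> is for the quotient, from which the energy cannot
      be recovered at 0; there the sum is empty.\<close>
    proof (cases "n = 0")
      case False
      then have "energy w n \<le> K * real n"
        using K(2)[of n] energy_nonneg[of w n] by (simp add: divide_le_eq)
      then show ?thesis by (simp only: energy_def)
    qed simp
    show ?case
    \<comment> \<open>The variable \<open>g\<close> is fixed only now, when \<open>w\<close> already
      lies outside a null set chosen independently of it.\<close>
    proof (intro allI impI, elim conjE)
      fix g assume g: "g \<in> borel_measurable PX" "distr PX borel g = std_normal_distribution"
      show "(\<lambda>n. dTV_X PX (trig_poly a b n w) g) \<longlonglongrightarrow> 0"
        unfolding trig_poly_eq_harmonic_sum
      proof (rule dTV_X_harmonic_sum_tendsto_0)
        show "weak_conv_m (\<lambda>n. distr PX borel (H 0 n w)) std_normal_distribution"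
          using elim(1) by (simp only: normal_law_one)
        show "weak_conv_m (\<lambda>n. distr PX borel (H 1 n w)) (normal_law (sqrt (1 / 3)))"
          by (rule elim(2))
        show "measure (normal_law (sqrt (1 / 3))) {0} = 0"
          by (rule measure_normal_law_0) simp
      qed (rule real_dist_normal_dist real_distribution_normal_law energy_le g)+
    qed
  qed
qed

end

theorem theorem5:
  fixes M :: "'a measure" and a b :: "nat \<Rightarrow> 'a \<Rightarrow> real"
  assumes "prob_space M"
    and rv: "\<And>k. k \<ge> 1 \<Longrightarrow> a k \<in> borel_measurable M \<and> b k \<in> borel_measurable M"
    and indep: "prob_space.indep_vars M (\<lambda>_. borel)
                  (\<lambda>i. case i of Inl k \<Rightarrow> a k | Inr k \<Rightarrow> b k) (Inl ` {1..} \<union> Inr ` {1..})"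
    and ident: "\<And>k. k \<ge> 1 \<Longrightarrow> distr M borel (a k) = distr M borel (a 1)
                                 \<and> distr M borel (b k) = distr M borel (a 1)"
    and third: "integrable M (\<lambda>w. \<bar>a 1 w\<bar> ^ 3)"
    and mean: "(\<integral>w. a 1 w \<partial>M) = 0"
    and var: "(\<integral>w. (a 1 w)\<^sup>2 \<partial>M) = 1"
  shows "AE w in M. \<forall>g. g \<in> borel_measurable PX \<and>
            distr PX borel g = density lborel std_normal_density \<longrightarrow>
            (\<lambda>n. dTV_X PX (trig_poly a b n w) g) \<longlonglongrightarrow> 0"
proof -
  interpret prob_space M by fact
  interpret iid_coefficients M a b
    by unfold_locales (fact rv indep ident third mean var)+
  show ?thesis by (rule AE_dTV_X_tendsto_0)
qed

end
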